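(* Let $V$ be a finite-dimensional complex representation of a complex reductive group $G$ with $\mathbb{C}(V)^G=\operatorname{Frac}(\mathbb{C}[V]^G)$, and let $K=\overline{\mathbb{C}(V)^G}$. Let $p\in\mathcal{M}$ be a closed point and suppose that the extension subvariety $Y=Y_p$ has the Galois restriction property (with respect to a finite group $W$). Then $Y$ has the Chevalley restriction property (with respect to $W$) if and only if $\mathbb{C}[Y]\cap\mathbb{C}(V)^G=\mathbb{C}[V]^G$, where the intersection is meant as an intersection of subrings of $K$.
   Context: $K$ is an algebraic closure of $\mathbb{C}(V)^G$. The extension parameter scheme is the $K$-scheme $\mathcal{M}=\operatorname{Spec}(\mathbb{C}[V]\otimes_{\mathbb{C}[V]^G}K)$, viewed as a closed subscheme of $\operatorname{Spec}(\mathbb{C}[V]\otimes_{\mathbb{C}}K)$. For a closed point $p\in\mathcal{M}$ with corresponding maximal ideal $\mathfrak{m}\subset\mathbb{C}[V]\otimes_{\mathbb{C}}K$, the associated extension subvariety $Y_p\subset V$ is the irreducible closed subvariety with coordinate ring $\mathbb{C}[Y_p]=\mathbb{C}[V]/(\mathfrak{m}\cap\mathbb{C}[V])$. The map $f\mapsto f\otimes1$ induces a canonical embedding $\mathbb{C}[Y_p]\to(\mathbb{C}[V]\otimes_{\mathbb{C}}K)/\mathfrak{m}\cong K$ which is compatible with the restriction map $\mathbb{C}[V]^G\to\mathbb{C}[Y_p]$ and the inclusion $\mathbb{C}[V]^G\subset K$; $\mathbb{C}[Y]$ is regarded as a subring of $K$ in this way. Galois restriction property: for $Y\subset V$ a closed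 subvariety and $W$ a finite group acting faithfully on $Y$ by birational automorphisms, $(Y,W)$ has this property if restriction of functions gives an isomorphism $\mathbb{C}(V)^G\to\mathbb{C}(Y)^W$. Chevalley restriction property: for $Y\subset V$ a closed subvariety and $W$ a finite group acting faithfully on $Y$ by regular automorphisms, $(Y,W)$ has this property if restriction of functions is an isomorphism $\mathbb{C}[V]^G\to\mathbb{C}[Y]^W$.
   Formalization: The equivalence with the Chevalley property is stated for W acting on Y by regular automorphisms, since the "if" direction fails for merely birational actions; for those, the equivalence is proved with C[Y]^W read as the intersection of C[Y] and C(Y)^W. *)

theory Defs
  imports
    "HOL-Analysis.Determinants"
    "HOL-Analysis.Abstract_Topology"
    "HOL-Algebra.Algebraic_Closure"
    "HOL-Algebra.QuotRing"
    "HOL-Library.Poly_Mapping"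
begin

section \<open>Polynomial functions and the Zariski topology\<close>

text \<open>A complex vector space is given by a type of class \<open>ab_group_add\<close> and its scalar
  multiplication \<open>scl\<close>, so that zero-dimensional spaces are included.  Since the
  field of complex numbers is infinite, \<open>\<complex>[V]\<close> is the ring of polynomial functions on \<open>V\<close>.\<close>

inductive_set polynomial_functions ::
    "(complex \<Rightarrow> 'v::ab_group_add \<Rightarrow> 'v) \<Rightarrow> ('v \<Rightarrow> complex) set"
  for scl :: "complex \<Rightarrow> 'v \<Rightarrow> 'v"
where
  const: "(\<lambda>v. c) \<in> polynomial_functions scl"
| linear: "Vector_Spaces.linear scl (*) f \<Longrightarrow> f \<in> polynomial_functions scl"
| add: "f \<in> polynomial_functions scl \<Longrightarrow> g \<in> polynomial_functions scl
      \<Longrightarrow> (\<lambda>v. f v + g v) \<in> polynomial_functions scl"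
| mult: "f \<in> polynomial_functions scl \<Longrightarrow> g \<in> polynomial_functions scl
      \<Longrightarrow> (\<lambda>v. f v * g v) \<in> polynomial_functions scl"

definition zariski :: "(complex \<Rightarrow> 'v::ab_group_add \<Rightarrow> 'v) \<Rightarrow> 'v topology" where
  "zariski scl =
     topology (\<lambda>U. \<exists>S. S \<subseteq> polynomial_functions scl \<and> U = {v. \<exists>f\<in>S. f v \<noteq> 0})"

lemma openin_zariski:
  "openin (zariski scl) U \<longleftrightarrow>
     (\<exists>S. S \<subseteq> polynomial_functions scl \<and> U = {v. \<exists>f\<in>S. f v \<noteq> 0})"
proof -
  let ?O = "\<lambda>U. \<exists>S. S \<subseteq> polynomial_functions scl \<and> U = {v. \<exists>f\<in>S. f v \<noteq> 0}"
  have int: "?O (A \<inter> B)" if "?O A" "?O B" for A B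
  proof -
    from that obtain S T
      where S: "S \<subseteq> polynomial_functions scl" "A = {v. \<exists>f\<in>S. f v \<noteq> 0}"
        and T: "T \<subseteq> polynomial_functions scl" "B = {v. \<exists>f\<in>T. f v \<noteq> 0}"
      by blast
    let ?P = "(\<lambda>(f, g). \<lambda>v. f v * g v) ` (S \<times> T)"
    have "?P \<subseteq> polynomial_functions scl"
      using S(1) T(1) by (auto intro: polynomial_functions.mult)
    moreover have "A \<inter> B = {v. \<exists>f\<in>?P. f v \<noteq> 0}"
      unfolding S(2) T(2) by auto
    ultimately show ?thesis by blast
  qed
  have union: "?O (\<Union>\<A>)" if "\<forall>A\<in>\<A>. ?O A" for \<A>
  proof -
    from bchoice[OF that] obtain S
      where S: "\<forall>A\<in>\<A>. S A \<subseteq> polynomial_functions scl \<and> A = {v. \<exists>f\<in>S A. f v \<noteq> 0}" ..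
    have "(\<Union>A\<in>\<A>. S A) \<subseteq> polynomial_functions scl"
      using S by blast
    moreover have "\<Union>\<A> = {v. \<exists>f\<in>(\<Union>A\<in>\<A>. S A). f v \<noteq> 0}"
      using S by blast
    ultimately show ?thesis by blast
  qed
  have "istopology ?O"
    unfolding istopology_def using int union by blast
  then show ?thesis
    by (simp add: zariski_def topology_inverse')
qed

definition irreducible_closed :: "(complex \<Rightarrow> 'v::ab_group_add \<Rightarrow> 'v) \<Rightarrow> 'v set \<Rightarrow> bool" where
  "irreducible_closed scl Y \<longleftrightarrow>
     closedin (zariski scl) Y \<and> Y \<noteq> {} \<and>
     (\<forall>A B. closedin (zariski scl) A \<and> closedin (zariski scl) B \<and> Y \<subseteq> A \<union> B
        \<longrightarrow> Y \<subseteq> A \<or> Y \<subseteq> B)"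


section \<open>Reductive groups and their representations\<close>

definition matrix_scale :: "complex \<Rightarrow> complex^'m^'m \<Rightarrow> complex^'m^'m" where
  "matrix_scale c A = (\<chi> i j. c * A $ i $ j)"

definition linear_algebraic_group :: "(complex^'m^'m) set \<Rightarrow> bool" where
  "linear_algebraic_group G \<longleftrightarrow>
     closedin (subtopology (zariski matrix_scale) {A. invertible A}) G \<and>
     mat 1 \<in> G \<and> (\<forall>g\<in>G. \<forall>h\<in>G. g ** h \<in> G) \<and> (\<forall>g\<in>G. matrix_inv g \<in> G)"

text \<open>The power is written as an iterated matrix product, as \<open>^\<close> on \<open>complex^'m^'m\<close> would be the
  componentwise power.\<close>

definition unipotent_matrix :: "complex^'m^'m \<Rightarrow> bool" where
  "unipotent_matrix A \<longleftrightarrow> (\<exists>k. (((\<lambda>B. (A - mat 1) ** B) ^^ k) (mat 1)) = 0)"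

text \<open>Reductive means trivial unipotent radical; the group itself need not be connected.\<close>

definition reductive_group :: "(complex^'m^'m) set \<Rightarrow> bool" where
  "reductive_group G \<longleftrightarrow>
     linear_algebraic_group G \<and>
     (\<forall>U. linear_algebraic_group U \<and> U \<subseteq> G \<and>
        (\<forall>g\<in>G. \<forall>u\<in>U. g ** u ** matrix_inv g \<in> U) \<and>
        connectedin (zariski matrix_scale) U \<and> (\<forall>u\<in>U. unipotent_matrix u)
        \<longrightarrow> U = {mat 1})"

definition regular_function_on_group ::
    "(complex^'m^'m) set \<Rightarrow> (complex^'m^'m \<Rightarrow> complex) \<Rightarrow> bool" where
  "regular_function_on_group G h \<longleftrightarrow>
     (\<exists>p\<in>polynomial_functions matrix_scale. \<exists>k. \<forall>g\<in>G. h g = p g / det g ^ k)"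

definition rational_representation ::
    "(complex \<Rightarrow> 'v::ab_group_add \<Rightarrow> 'v) \<Rightarrow> (complex^'m^'m) set
     \<Rightarrow> (complex^'m^'m \<Rightarrow> 'v \<Rightarrow> 'v) \<Rightarrow> bool" where
  "rational_representation scl G \<rho> \<longleftrightarrow>
     (\<forall>g\<in>G. Vector_Spaces.linear scl scl (\<rho> g)) \<and>
     \<rho> (mat 1) = id \<and> (\<forall>g\<in>G. \<forall>h\<in>G. \<rho> (g ** h) = \<rho> g \<circ> \<rho> h) \<and>
     (\<forall>l v. Vector_Spaces.linear scl (*) l
        \<longrightarrow> regular_function_on_group G (\<lambda>g. l (\<rho> g v)))"


section \<open>Coordinate rings and function fields\<close>

text \<open>For closed \<open>Y\<close> this is \<open>\<complex>[Y]\<close>, as the ring of restrictions to \<open>Y\<close> of polynomial functions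
  (made \<open>undefined\<close> outside \<open>Y\<close>); in particular \<open>\<complex>[V]\<close> is the case \<open>Y = UNIV\<close>.\<close>

definition coordinate_ring ::
    "(complex \<Rightarrow> 'v::ab_group_add \<Rightarrow> 'v) \<Rightarrow> 'v set \<Rightarrow> ('v \<Rightarrow> complex) ring" where
  "coordinate_ring scl Y =
     \<lparr>carrier = (\<lambda>f. restrict f Y) ` polynomial_functions scl,
      mult = (\<lambda>f g. \<lambda>v\<in>Y. f v * g v), one = (\<lambda>v\<in>Y. 1),
      zero = (\<lambda>v\<in>Y. 0), add = (\<lambda>f g. \<lambda>v\<in>Y. f v + g v)\<rparr>"

text \<open>The fraction \<open>a / b\<close> is the class of all pairs \<open>(c, d)\<close> with \<open>d \<noteq> 0\<close> and \<open>a d = c b\<close>.\<close>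

definition fraction :: "('a, 'b) ring_scheme \<Rightarrow> 'a \<Rightarrow> 'a \<Rightarrow> ('a \<times> 'a) set" where
  "fraction R a b =
     {(c, d). c \<in> carrier R \<and> d \<in> carrier R - {\<zero>\<^bsub>R\<^esub>} \<and> a \<otimes>\<^bsub>R\<^esub> d = c \<otimes>\<^bsub>R\<^esub> b}"

definition fraction_field :: "('a, 'b) ring_scheme \<Rightarrow> ('a \<times> 'a) set ring" where
  "fraction_field R =
     \<lparr>carrier = {fraction R a b | a b. a \<in> carrier R \<and> b \<in> carrier R - {\<zero>\<^bsub>R\<^esub>}},
      mult = (\<lambda>r s. \<Union>(a, b)\<in>r. \<Union>(c, d)\<in>s. fraction R (a \<otimes>\<^bsub>R\<^esub> c) (b \<otimes>\<^bsub>R\<^esub> d)),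
      one = fraction R \<one>\<^bsub>R\<^esub> \<one>\<^bsub>R\<^esub>,
      zero = fraction R \<zero>\<^bsub>R\<^esub> \<one>\<^bsub>R\<^esub>,
      add = (\<lambda>r s. \<Union>(a, b)\<in>r. \<Union>(c, d)\<in>s.
               fraction R (a \<otimes>\<^bsub>R\<^esub> d \<oplus>\<^bsub>R\<^esub> c \<otimes>\<^bsub>R\<^esub> b) (b \<otimes>\<^bsub>R\<^esub> d))\<rparr>"

abbreviation function_field ::
    "(complex \<Rightarrow> 'v::ab_group_add \<Rightarrow> 'v) \<Rightarrow> 'v set
     \<Rightarrow> (('v \<Rightarrow> complex) \<times> ('v \<Rightarrow> complex)) set ring" where
  "function_field scl Y \<equiv> fraction_field (coordinate_ring scl Y)"


section \<open>Regular and birational automorphisms\<close>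

text \<open>For irreducible \<open>Y\<close>, the nonempty open subsets of \<open>Y\<close> are dense.\<close>

definition generically ::
    "(complex \<Rightarrow> 'v::ab_group_add \<Rightarrow> 'v) \<Rightarrow> 'v set \<Rightarrow> ('v \<Rightarrow> bool) \<Rightarrow> bool" where
  "generically scl Y P \<longleftrightarrow>
     (\<exists>U. openin (subtopology (zariski scl) Y) U \<and> U \<noteq> {} \<and> (\<forall>y\<in>U. P y))"

definition regular_function_on ::
    "(complex \<Rightarrow> 'v::ab_group_add \<Rightarrow> 'v) \<Rightarrow> 'v set \<Rightarrow> 'v set \<Rightarrow> ('v \<Rightarrow> complex) \<Rightarrow> bool" where
  "regular_function_on scl Y D h \<longleftrightarrow>
     (\<forall>x\<in>D. \<exists>N. openin (subtopology (zariski scl) Y) N \<and> x \<in> N \<and> N \<subseteq> D \<and>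
        (\<exists>a\<in>polynomial_functions scl. \<exists>b\<in>polynomial_functions scl.
           \<forall>y\<in>N. b y \<noteq> 0 \<and> h y = a y / b y))"

definition regular_map ::
    "(complex \<Rightarrow> 'v::ab_group_add \<Rightarrow> 'v) \<Rightarrow> 'v set \<Rightarrow> 'v set \<Rightarrow> ('v \<Rightarrow> 'v) \<Rightarrow> bool" where
  "regular_map scl Y D \<phi> \<longleftrightarrow>
     \<phi> ` D \<subseteq> Y \<and>
     (\<forall>f\<in>polynomial_functions scl. regular_function_on scl Y D (\<lambda>y. f (\<phi> y)))"

text \<open>A rational map from \<open>Y\<close> to \<open>Y\<close> is represented by a total function that is regular on some
  nonempty open subset of \<open>Y\<close>; its values elsewhere are irrelevant.  Two functions represent
  the same rational map iff they agree generically.\<close>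

definition dominant_rational_map ::
    "(complex \<Rightarrow> 'v::ab_group_add \<Rightarrow> 'v) \<Rightarrow> 'v set \<Rightarrow> ('v \<Rightarrow> 'v) \<Rightarrow> bool" where
  "dominant_rational_map scl Y \<phi> \<longleftrightarrow>
     (\<exists>D. openin (subtopology (zariski scl) Y) D \<and> D \<noteq> {} \<and> regular_map scl Y D \<phi> \<and>
        Y \<subseteq> zariski scl closure_of (\<phi> ` D))"

definition birational_automorphism ::
    "(complex \<Rightarrow> 'v::ab_group_add \<Rightarrow> 'v) \<Rightarrow> 'v set \<Rightarrow> ('v \<Rightarrow> 'v) \<Rightarrow> bool" where
  "birational_automorphism scl Y \<phi> \<longleftrightarrow>
     dominant_rational_map scl Y \<phi> \<and>
     (\<exists>\<psi>. dominant_rational_map scl Y \<psi> \<and>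
        generically scl Y (\<lambda>y. \<psi> (\<phi> y) = y) \<and> generically scl Y (\<lambda>y. \<phi> (\<psi> y) = y))"

definition regular_automorphism ::
    "(complex \<Rightarrow> 'v::ab_group_add \<Rightarrow> 'v) \<Rightarrow> 'v set \<Rightarrow> ('v \<Rightarrow> 'v) \<Rightarrow> bool" where
  "regular_automorphism scl Y \<phi> \<longleftrightarrow>
     regular_map scl Y Y \<phi> \<and>
     (\<exists>\<psi>. regular_map scl Y Y \<psi> \<and> (\<forall>y\<in>Y. \<psi> (\<phi> y) = y) \<and> (\<forall>y\<in>Y. \<phi> (\<psi> y) = y))"

definition faithful_birational_action ::
    "(complex \<Rightarrow> 'v::ab_group_add \<Rightarrow> 'v) \<Rightarrow> 'v set \<Rightarrow> 'w monoid \<Rightarrow> ('w \<Rightarrow> 'v \<Rightarrow> 'v) \<Rightarrow> bool"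
where
  "faithful_birational_action scl Y W \<phi> \<longleftrightarrow>
     group W \<and> finite (carrier W) \<and>
     (\<forall>w\<in>carrier W. birational_automorphism scl Y (\<phi> w)) \<and>
     generically scl Y (\<lambda>y. \<phi> \<one>\<^bsub>W\<^esub> y = y) \<and>
     (\<forall>w\<in>carrier W. \<forall>w'\<in>carrier W.
        generically scl Y (\<lambda>y. \<phi> (w \<otimes>\<^bsub>W\<^esub> w') y = \<phi> w (\<phi> w' y))) \<and>
     (\<forall>w\<in>carrier W. generically scl Y (\<lambda>y. \<phi> w y = y) \<longrightarrow> w = \<one>\<^bsub>W\<^esub>)"

definition faithful_regular_action ::
    "(complex \<Rightarrow> 'v::ab_group_add \<Rightarrow> 'v) \<Rightarrow> 'v set \<Rightarrow> 'w monoid \<Rightarrow> ('w \<Rightarrow> 'v \<Rightarrow> 'v) \<Rightarrow> bool"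
where
  "faithful_regular_action scl Y W \<phi> \<longleftrightarrow>
     group W \<and> finite (carrier W) \<and>
     (\<forall>w\<in>carrier W. regular_automorphism scl Y (\<phi> w)) \<and>
     (\<forall>y\<in>Y. \<phi> \<one>\<^bsub>W\<^esub> y = y) \<and>
     (\<forall>w\<in>carrier W. \<forall>w'\<in>carrier W. \<forall>y\<in>Y. \<phi> (w \<otimes>\<^bsub>W\<^esub> w') y = \<phi> w (\<phi> w' y)) \<and>
     (\<forall>w\<in>carrier W. (\<forall>y\<in>Y. \<phi> w y = y) \<longrightarrow> w = \<one>\<^bsub>W\<^esub>)"


section \<open>Rings and fields of invariants\<close>

text \<open>The acting set is \<open>G\<close> (acting on \<open>V = UNIV\<close> by \<open>\<rho>\<close>) or \<open>carrier W\<close> (acting on \<open>Y\<close>).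
  As the acting set is closed under inverses, it does not matter whether an element
  acts on functions through itself or through its inverse.\<close>

definition invariant_ring ::
    "(complex \<Rightarrow> 'v::ab_group_add \<Rightarrow> 'v) \<Rightarrow> 'v set \<Rightarrow> 's set \<Rightarrow> ('s \<Rightarrow> 'v \<Rightarrow> 'v)
     \<Rightarrow> ('v \<Rightarrow> complex) ring" where
  "invariant_ring scl Y S act =
     (coordinate_ring scl Y)
       \<lparr>carrier := {f \<in> carrier (coordinate_ring scl Y). \<forall>s\<in>S. \<forall>y\<in>Y. f (act s y) = f y}\<rparr>"

definition invariant_field ::
    "(complex \<Rightarrow> 'v::ab_group_add \<Rightarrow> 'v) \<Rightarrow> 'v set \<Rightarrow> 's set \<Rightarrow> ('s \<Rightarrow> 'v \<Rightarrow> 'v)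
     \<Rightarrow> (('v \<Rightarrow> complex) \<times> ('v \<Rightarrow> complex)) set ring" where
  "invariant_field scl Y S act =
     (function_field scl Y)
       \<lparr>carrier := {r \<in> carrier (function_field scl Y). \<forall>(a, b)\<in>r. \<forall>s\<in>S.
          generically scl Y (\<lambda>y. act s y \<in> Y \<and> b y \<noteq> 0 \<and> b (act s y) \<noteq> 0 \<and>
            a (act s y) / b (act s y) = a y / b y)}\<rparr>"

text \<open>The ring \<open>\<complex>[Y] \<inter> \<complex>(Y)\<^sup>W\<close> of regular functions that are invariant as rational functions.  It
  makes sense for a birational action, where \<open>\<complex>[Y]\<close> itself need not be stable under \<open>W\<close>.\<close>

definition birational_invariant_ring ::
    "(complex \<Rightarrow> 'v::ab_group_add \<Rightarrow> 'v) \<Rightarrow> 'v set \<Rightarrow> 's set \<Rightarrow> ('s \<Rightarrow> 'v \<Rightarrow> 'v)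
     \<Rightarrow> ('v \<Rightarrow> complex) ring" where
  "birational_invariant_ring scl Y S act =
     (coordinate_ring scl Y)
       \<lparr>carrier := {h \<in> carrier (coordinate_ring scl Y).
          fraction (coordinate_ring scl Y) h \<one>\<^bsub>coordinate_ring scl Y\<^esub>
            \<in> carrier (invariant_field scl Y S act)}\<rparr>"


section \<open>The restriction properties\<close>

text \<open>All pairs \<open>(a, b)\<close> in the union yield the same class.  If \<open>r\<close> has no representative with
  denominator nonzero on \<open>Y\<close>, the value is the empty set, which is not an element of \<open>\<complex>(Y)\<close>.\<close>

definition restrict_rational ::
    "(complex \<Rightarrow> 'v::ab_group_add \<Rightarrow> 'v) \<Rightarrow> 'v set \<Rightarrow> (('v \<Rightarrow> complex) \<times> ('v \<Rightarrow> complex)) set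
     \<Rightarrow> (('v \<Rightarrow> complex) \<times> ('v \<Rightarrow> complex)) set" where
  "restrict_rational scl Y r =
     (\<Union>(a, b)\<in>{(a, b). (a, b) \<in> r \<and> (\<exists>y\<in>Y. b y \<noteq> 0)}.
        fraction (coordinate_ring scl Y) (restrict a Y) (restrict b Y))"

definition galois_restriction_property ::
    "(complex \<Rightarrow> 'v::ab_group_add \<Rightarrow> 'v) \<Rightarrow> (complex^'m^'m) set \<Rightarrow> (complex^'m^'m \<Rightarrow> 'v \<Rightarrow> 'v)
     \<Rightarrow> 'v set \<Rightarrow> 'w monoid \<Rightarrow> ('w \<Rightarrow> 'v \<Rightarrow> 'v) \<Rightarrow> bool" where
  "galois_restriction_property scl G \<rho> Y W \<phi> \<longleftrightarrow>
     irreducible_closed scl Y \<and> faithful_birational_action scl Y W \<phi> \<and>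
     restrict_rational scl Y
       \<in> ring_iso (invariant_field scl UNIV G \<rho>) (invariant_field scl Y (carrier W) \<phi>)"

definition chevalley_restriction_property ::
    "(complex \<Rightarrow> 'v::ab_group_add \<Rightarrow> 'v) \<Rightarrow> (complex^'m^'m) set \<Rightarrow> (complex^'m^'m \<Rightarrow> 'v \<Rightarrow> 'v)
     \<Rightarrow> 'v set \<Rightarrow> 'w monoid \<Rightarrow> ('w \<Rightarrow> 'v \<Rightarrow> 'v) \<Rightarrow> bool" where
  "chevalley_restriction_property scl G \<rho> Y W \<phi> \<longleftrightarrow>
     irreducible_closed scl Y \<and> faithful_regular_action scl Y W \<phi> \<and>
     (\<lambda>f. restrict f Y)
       \<in> ring_iso (invariant_ring scl UNIV G \<rho>) (invariant_ring scl Y (carrier W) \<phi>)"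


section \<open>Tensor products of commutative algebras\<close>

text \<open>For \<open>R\<close>-algebras \<open>A\<close> and \<open>B\<close> with structure maps \<open>\<alpha>\<close> and \<open>\<beta>\<close>, the tensor product of \<open>A\<close> and \<open>B\<close>
  over \<open>R\<close> is the quotient of the monoid ring of the multiplicative monoid of pairs (the free
  abelian group on \<open>carrier A \<times> carrier B\<close>) by the ideal generated by the bilinearity and balancing
  relations.\<close>

definition pair_ring ::
    "('a, 'c) ring_scheme \<Rightarrow> ('b, 'd) ring_scheme \<Rightarrow> (('a \<times> 'b) \<Rightarrow>\<^sub>0 int) ring" where
  "pair_ring A B =
     \<lparr>carrier = {c. Poly_Mapping.keys c \<subseteq> carrier A \<times> carrier B},
      mult = (\<lambda>c d. frag_extend (\<lambda>(a, b). frag_extend (\<lambda>(a', b').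
                frag_of (a \<otimes>\<^bsub>A\<^esub> a', b \<otimes>\<^bsub>B\<^esub> b')) d) c),
      one = frag_of (\<one>\<^bsub>A\<^esub>, \<one>\<^bsub>B\<^esub>), zero = 0, add = (+)\<rparr>"

definition tensor_relations ::
    "('r, 'e) ring_scheme \<Rightarrow> ('a, 'c) ring_scheme \<Rightarrow> ('b, 'd) ring_scheme
     \<Rightarrow> ('r \<Rightarrow> 'a) \<Rightarrow> ('r \<Rightarrow> 'b) \<Rightarrow> (('a \<times> 'b) \<Rightarrow>\<^sub>0 int) set" where
  "tensor_relations R A B \<alpha> \<beta> =
     {frag_of (a \<oplus>\<^bsub>A\<^esub> a', b) - frag_of (a, b) - frag_of (a', b) | a a' b.
        a \<in> carrier A \<and> a' \<in> carrier A \<and> b \<in> carrier B} \<union>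
     {frag_of (a, b \<oplus>\<^bsub>B\<^esub> b') - frag_of (a, b) - frag_of (a, b') | a b b'.
        a \<in> carrier A \<and> b \<in> carrier B \<and> b' \<in> carrier B} \<union>
     {frag_of (\<alpha> r \<otimes>\<^bsub>A\<^esub> a, b) - frag_of (a, \<beta> r \<otimes>\<^bsub>B\<^esub> b) | r a b.
        r \<in> carrier R \<and> a \<in> carrier A \<and> b \<in> carrier B}"

definition tensor_ideal where
  "tensor_ideal R A B \<alpha> \<beta> = Idl\<^bsub>pair_ring A B\<^esub> (tensor_relations R A B \<alpha> \<beta>)"

definition tensor_ring ::
    "('r, 'e) ring_scheme \<Rightarrow> ('a, 'c) ring_scheme \<Rightarrow> ('b, 'd) ring_scheme
     \<Rightarrow> ('r \<Rightarrow> 'a) \<Rightarrow> ('r \<Rightarrow> 'b) \<Rightarrow> (('a \<times> 'b) \<Rightarrow>\<^sub>0 int) set ring" where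
  "tensor_ring R A B \<alpha> \<beta> = pair_ring A B Quot tensor_ideal R A B \<alpha> \<beta>"

definition pure_tensor ::
    "('r, 'e) ring_scheme \<Rightarrow> ('a, 'c) ring_scheme \<Rightarrow> ('b, 'd) ring_scheme
     \<Rightarrow> ('r \<Rightarrow> 'a) \<Rightarrow> ('r \<Rightarrow> 'b) \<Rightarrow> 'a \<Rightarrow> 'b \<Rightarrow> (('a \<times> 'b) \<Rightarrow>\<^sub>0 int) set" where
  "pure_tensor R A B \<alpha> \<beta> a b = tensor_ideal R A B \<alpha> \<beta> +>\<^bsub>pair_ring A B\<^esub> frag_of (a, b)"


section \<open>The extension parameter scheme and extension subvarieties\<close>

text \<open>Throughout, \<open>K\<close> is a ring record and \<open>\<iota>\<close> is the inclusion of \<open>\<complex>(V)\<^sup>G\<close> into \<open>K\<close>.  The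
  next map is the inclusion of \<open>\<complex>[V]\<^sup>G\<close> into \<open>K\<close>, and \<open>extension_ring\<close> is the coordinate ring
  of the extension parameter scheme, whose closed points are the maximal ideals of that ring.\<close>

definition invariant_inclusion ::
    "(complex \<Rightarrow> 'v::ab_group_add \<Rightarrow> 'v) \<Rightarrow> ((('v \<Rightarrow> complex) \<times> ('v \<Rightarrow> complex)) set \<Rightarrow> 'k)
     \<Rightarrow> ('v \<Rightarrow> complex) \<Rightarrow> 'k" where
  "invariant_inclusion scl \<iota> f =
     \<iota> (fraction (coordinate_ring scl UNIV) f \<one>\<^bsub>coordinate_ring scl UNIV\<^esub>)"

definition extension_ring ::
    "(complex \<Rightarrow> 'v::ab_group_add \<Rightarrow> 'v) \<Rightarrow> (complex^'m^'m) set \<Rightarrow> (complex^'m^'m \<Rightarrow> 'v \<Rightarrow> 'v)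
     \<Rightarrow> 'k ring \<Rightarrow> ((('v \<Rightarrow> complex) \<times> ('v \<Rightarrow> complex)) set \<Rightarrow> 'k)
     \<Rightarrow> ((('v \<Rightarrow> complex) \<times> 'k) \<Rightarrow>\<^sub>0 int) set ring" where
  "extension_ring scl G \<rho> K \<iota> =
     tensor_ring (invariant_ring scl UNIV G \<rho>) (coordinate_ring scl UNIV) K
       id (invariant_inclusion scl \<iota>)"

definition extension_tensor ::
    "(complex \<Rightarrow> 'v::ab_group_add \<Rightarrow> 'v) \<Rightarrow> (complex^'m^'m) set \<Rightarrow> (complex^'m^'m \<Rightarrow> 'v \<Rightarrow> 'v)
     \<Rightarrow> 'k ring \<Rightarrow> ((('v \<Rightarrow> complex) \<times> ('v \<Rightarrow> complex)) set \<Rightarrow> 'k)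
     \<Rightarrow> ('v \<Rightarrow> complex) \<Rightarrow> 'k \<Rightarrow> ((('v \<Rightarrow> complex) \<times> 'k) \<Rightarrow>\<^sub>0 int) set" where
  "extension_tensor scl G \<rho> K \<iota> =
     pure_tensor (invariant_ring scl UNIV G \<rho>) (coordinate_ring scl UNIV) K
       id (invariant_inclusion scl \<iota>)"

text \<open>\<open>Y\<close> is the irreducible closed subvariety whose vanishing ideal is the contraction of the
  maximal ideal \<open>\<mm>\<close> to \<open>\<complex>[V]\<close>.\<close>

definition is_extension_subvariety ::
    "(complex \<Rightarrow> 'v::ab_group_add \<Rightarrow> 'v) \<Rightarrow> (complex^'m^'m) set \<Rightarrow> (complex^'m^'m \<Rightarrow> 'v \<Rightarrow> 'v)
     \<Rightarrow> 'k ring \<Rightarrow> ((('v \<Rightarrow> complex) \<times> ('v \<Rightarrow> complex)) set \<Rightarrow> 'k)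
     \<Rightarrow> ((('v \<Rightarrow> complex) \<times> 'k) \<Rightarrow>\<^sub>0 int) set set \<Rightarrow> 'v set \<Rightarrow> bool" where
  "is_extension_subvariety scl G \<rho> K \<iota> \<mm> Y \<longleftrightarrow>
     irreducible_closed scl Y \<and>
     {f \<in> polynomial_functions scl. \<forall>y\<in>Y. f y = 0} =
     {f \<in> polynomial_functions scl. extension_tensor scl G \<rho> K \<iota> f \<one>\<^bsub>K\<^esub> \<in> \<mm>}"

text \<open>\<open>\<complex>[Y]\<close> as a subring of \<open>K\<close>: the elements of \<open>K\<close> that correspond to the class of some
  \<open>f \<otimes> 1\<close> under the canonical isomorphism of \<open>K\<close> with the residue field at \<open>\<mm>\<close>, which sends
  \<open>c\<close> to the class of \<open>1 \<otimes> c\<close>.\<close>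

definition embedded_coordinate_ring ::
    "(complex \<Rightarrow> 'v::ab_group_add \<Rightarrow> 'v) \<Rightarrow> (complex^'m^'m) set \<Rightarrow> (complex^'m^'m \<Rightarrow> 'v \<Rightarrow> 'v)
     \<Rightarrow> 'k ring \<Rightarrow> ((('v \<Rightarrow> complex) \<times> ('v \<Rightarrow> complex)) set \<Rightarrow> 'k)
     \<Rightarrow> ((('v \<Rightarrow> complex) \<times> 'k) \<Rightarrow>\<^sub>0 int) set set \<Rightarrow> 'k set" where
  "embedded_coordinate_ring scl G \<rho> K \<iota> \<mm> =
     {c \<in> carrier K. \<exists>f\<in>polynomial_functions scl.
        \<mm> +>\<^bsub>extension_ring scl G \<rho> K \<iota>\<^esub> extension_tensor scl G \<rho> K \<iota> f \<one>\<^bsub>K\<^esub> =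
        \<mm> +>\<^bsub>extension_ring scl G \<rho> K \<iota>\<^esub>
          extension_tensor scl G \<rho> K \<iota> \<one>\<^bsub>coordinate_ring scl UNIV\<^esub> c}"

end

theory Submission
  imports Defs "HOL-Computational_Algebra.Polynomial"
begin

text \<open>Inside the residue ring of \<open>\<mm>\<close>, an invariant function \<open>a \<otimes> 1\<close> equals \<open>1 \<otimes> a\<close>, and \<open>f \<otimes> 1\<close>
  vanishes iff \<open>f\<close> vanishes on \<open>Y\<close>.  Hence for an invariant fraction \<open>r = a / b\<close> the denominator does
  not vanish on \<open>Y\<close>, and \<open>r\<close>, viewed in \<open>K\<close>, lies in \<open>\<complex>[Y]\<close> iff its restriction to \<open>Y\<close> is a regular
  function.  So the restriction isomorphism \<open>\<complex>(V)\<^sup>G \<cong> \<complex>(Y)\<^sup>W\<close> carries \<open>\<complex>[Y] \<inter> \<complex>(V)\<^sup>G\<close> onto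
  \<open>\<complex>[Y] \<inter> \<complex>(Y)\<^sup>W\<close>, and this target is the image of \<open>\<complex>[V]\<^sup>G\<close> exactly when the source is \<open>\<complex>[V]\<^sup>G\<close>.
  For a regular action the target is \<open>\<complex>[Y]\<^sup>W\<close> by irreducibility of \<open>Y\<close>.  Only the injectivity of
  \<open>K\<close> into the residue ring is needed, so the Nullstellensatz is not used.\<close>

section \<open>Fractions over a domain\<close>

context domain
begin

text \<open>A class contains its own defining pair, which gives one direction. The other is
  transitivity of cross-multiplication: the two given equations agree only after multiplication by
  \<open>b\<close>, and cancelling the nonzero \<open>b\<close> uses that \<open>R\<close> is a
  domain.\<close>

lemma fraction_eq_iff:
  assumes "a \<in> carrier R" "b \<in> carrier R - {\<zero>}" "c \<in> carrier R" "d \<in> carrier R - {\<zero>}"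
  shows "fraction R a b = fraction R c d \<longleftrightarrow> a \<otimes> d = c \<otimes> b"
proof
  assume "fraction R a b = fraction R c d"
  moreover have "(c, d) \<in> fraction R c d"
    using assms by (simp add: fraction_def)
  ultimately show "a \<otimes> d = c \<otimes> b"
    by (auto simp: fraction_def)
next
  have aux: "fraction R a b \<subseteq> fraction R c d"
    if car: "a \<in> carrier R" "b \<in> carrier R - {\<zero>}" "c \<in> carrier R" "d \<in> carrier R - {\<zero>}"
      and eq: "a \<otimes> d = c \<otimes> b" for a b c d
  proof
    fix z assume z: "z \<in> fraction R a b"
    obtain x y where xy: "z = (x, y)" by (cases z)
    with z have x: "x \<in> carrier R" "y \<in> carrier R - {\<zero>}" "a \<otimes> y = x \<otimes> b"
      by (auto simp: fraction_def)
    have "(c \<otimes> y) \<otimes> b = (c \<otimes> b) \<otimes> y"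
      using x car by (simp add: m_ac)
    also have "\<dots> = (a \<otimes> y) \<otimes> d"
      using x(1,2) car by (simp add: eq[symmetric] m_ac)
    also have "\<dots> = (x \<otimes> d) \<otimes> b"
      using x(1,2) car by (simp add: x(3) m_ac)
    finally have "c \<otimes> y = x \<otimes> d"
      using x car by (auto simp: m_rcancel)
    with x xy show "z \<in> fraction R c d"
      by (simp add: fraction_def)
  qed
  assume "a \<otimes> d = c \<otimes> b"
  then show "fraction R a b = fraction R c d"
    using aux[of a b c d] aux[of c d a b] assms by auto
qed

text \<open>The product is a union over all pairs of representatives. Each pair contributes the same
  class, so the union over the nonempty index sets collapses to that class.\<close>

lemma fraction_field_mult:
  assumes "a \<in> carrier R" "b \<in> carrier R - {\<zero>}" "c \<in> carrier R" "d \<in> carrier R - {\<zero>}"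
  shows "fraction R a b \<otimes>\<^bsub>fraction_field R\<^esub> fraction R c d = fraction R (a \<otimes> c) (b \<otimes> d)"
proof -
  have "fraction R (x \<otimes> x') (y \<otimes> y') = fraction R (a \<otimes> c) (b \<otimes> d)"
    if "(x, y) \<in> fraction R a b" "(x', y') \<in> fraction R c d" for x y x' y'
  proof -
    have x: "x \<in> carrier R" "y \<in> carrier R - {\<zero>}" "a \<otimes> y = x \<otimes> b"
      and x': "x' \<in> carrier R" "y' \<in> carrier R - {\<zero>}" "c \<otimes> y' = x' \<otimes> d"
      using that by (auto simp: fraction_def)
    have "(x \<otimes> x') \<otimes> (b \<otimes> d) = (x \<otimes> b) \<otimes> (x' \<otimes> d)"
      using x x' assms by (simp add: m_ac)
    also have "\<dots> = (a \<otimes> c) \<otimes> (y \<otimes> y')"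
      using x(1,2) x'(1,2) assms by (simp add: x(3)[symmetric] x'(3)[symmetric] m_ac)
    finally show ?thesis
      using x x' assms by (subst fraction_eq_iff) (auto simp: integral_iff)
  qed
  note const = this
  have "(a, b) \<in> fraction R a b" "(c, d) \<in> fraction R c d"
    using assms by (auto simp: fraction_def)
  then have ne: "fraction R a b \<noteq> {}" "fraction R c d \<noteq> {}"
    by blast+
  have "(\<Union>(x, y)\<in>fraction R a b. \<Union>(x', y')\<in>fraction R c d. fraction R (x \<otimes> x') (y \<otimes> y')) =
      fraction R (a \<otimes> c) (b \<otimes> d)"
  proof (rule SUP_eq_const[OF ne(1)])
    fix z assume z: "z \<in> fraction R a b"
    obtain x y where xy: "z = (x, y)" by (cases z)
    have "(\<Union>(x', y')\<in>fraction R c d. fraction R (x \<otimes> x') (y \<otimes> y')) =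
        fraction R (a \<otimes> c) (b \<otimes> d)"
    proof (rule SUP_eq_const[OF ne(2)])
      fix z' assume z': "z' \<in> fraction R c d"
      obtain x' y' where xy': "z' = (x', y')" by (cases z')
      show "(case z' of (x', y') \<Rightarrow> fraction R (x \<otimes> x') (y \<otimes> y')) = fraction R (a \<otimes> c) (b \<otimes> d)"
        using const[of x y x' y'] z z' unfolding xy xy' by simp
    qed
    then show "(case z of (x, y) \<Rightarrow> \<Union>(x', y')\<in>fraction R c d. fraction R (x \<otimes> x') (y \<otimes> y')) =
        fraction R (a \<otimes> c) (b \<otimes> d)"
      unfolding xy by simp
  qed
  then show ?thesis
    by (simp add: fraction_field_def)
qed

text \<open>Characterises a fraction by a multiplicative equation, a form that a ring homomorphism
  can transport.\<close>

lemma fraction_mult_denominator: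
  assumes "a \<in> carrier R" "b \<in> carrier R - {\<zero>}"
  shows "fraction R a b \<otimes>\<^bsub>fraction_field R\<^esub> fraction R b \<one> = fraction R a \<one>"
proof -
  have "fraction R (a \<otimes> b) (b \<otimes> \<one>) = fraction R a \<one>"
    using assms by (subst fraction_eq_iff) simp_all
  moreover have "fraction R a b \<otimes>\<^bsub>fraction_field R\<^esub> fraction R b \<one> =
      fraction R (a \<otimes> b) (b \<otimes> \<one>)"
    using assms by (intro fraction_field_mult) auto
  ultimately show ?thesis by simp
qed

end


section \<open>Coordinate rings\<close>

lemma polynomial_functions_diff:
  assumes "f \<in> polynomial_functions scl" "g \<in> polynomial_functions scl"
  shows "(\<lambda>v. f v - g v) \<in> polynomial_functions scl"
  using polynomial_functions.add[OF assms(1)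
      polynomial_functions.mult[OF polynomial_functions.const[of "-1"] assms(2)]]
  by simp

lemma coordinate_ring_simps [simp]:
  "carrier (coordinate_ring scl Y) = (\<lambda>f. restrict f Y) ` polynomial_functions scl"
  "f \<otimes>\<^bsub>coordinate_ring scl Y\<^esub> g = (\<lambda>v\<in>Y. f v * g v)"
  "f \<oplus>\<^bsub>coordinate_ring scl Y\<^esub> g = (\<lambda>v\<in>Y. f v + g v)"
  "\<one>\<^bsub>coordinate_ring scl Y\<^esub> = (\<lambda>v\<in>Y. 1)"
  "\<zero>\<^bsub>coordinate_ring scl Y\<^esub> = (\<lambda>v\<in>Y. 0)"
  by (simp_all add: coordinate_ring_def)

lemma coordinate_ring_cring: "cring (coordinate_ring scl Y)"
proof (rule cringI)
  \<comment> \<open>Dropping the inner restrictions reduces the ring axioms to pointwise identities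
    of complex numbers.\<close>
  have restr: "restrict (\<lambda>v. F (restrict f Y v) (restrict g Y v)) Y = restrict (\<lambda>v. F (f v) (g v)) Y"
    for F :: "complex \<Rightarrow> complex \<Rightarrow> complex" and f g
    by auto
  show "abelian_group (coordinate_ring scl Y)"
  proof (rule abelian_groupI)
    fix f assume "f \<in> carrier (coordinate_ring scl Y)"
    then obtain p where p: "p \<in> polynomial_functions scl" "f = restrict p Y"
      by auto
    have "restrict (\<lambda>v. (-1) * p v) Y \<in> carrier (coordinate_ring scl Y)"
      unfolding coordinate_ring_simps
      by (intro imageI polynomial_functions.mult polynomial_functions.const p)
    then show "\<exists>g\<in>carrier (coordinate_ring scl Y).
        g \<oplus>\<^bsub>coordinate_ring scl Y\<^esub> f = \<zero>\<^bsub>coordinate_ring scl Y\<^esub>"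
      by (rule rev_bexI) (auto simp: p)
  qed (auto simp: restr polynomial_functions.intros add_ac cong: restrict_cong)
  show "Group.comm_monoid (coordinate_ring scl Y)"
    by (rule comm_monoidI)
      (auto simp: restr polynomial_functions.intros mult_ac cong: restrict_cong)
qed (auto simp: algebra_simps cong: restrict_cong)

text \<open>Stated through polynomial functions so as to serve both \<open>V\<close>, where zero
  products are excluded along lines, and \<open>Y\<close>, where irreducibility excludes
  them.\<close>

lemma coordinate_ring_domain:
  assumes "Y \<noteq> {}"
    and "\<And>f g. f \<in> polynomial_functions scl \<Longrightarrow> g \<in> polynomial_functions scl \<Longrightarrow>
      \<forall>y\<in>Y. f y * g y = 0 \<Longrightarrow> (\<forall>y\<in>Y. f y = 0) \<or> (\<forall>y\<in>Y. g y = 0)"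
  shows "domain (coordinate_ring scl Y)"
proof (rule domain.intro[OF coordinate_ring_cring], unfold_locales)
  show "\<one>\<^bsub>coordinate_ring scl Y\<^esub> \<noteq> \<zero>\<^bsub>coordinate_ring scl Y\<^esub>"
    using assms(1) by (auto simp: fun_eq_iff restrict_def)
next
  fix f g
  assume 0: "f \<otimes>\<^bsub>coordinate_ring scl Y\<^esub> g = \<zero>\<^bsub>coordinate_ring scl Y\<^esub>"
    and "f \<in> carrier (coordinate_ring scl Y)" "g \<in> carrier (coordinate_ring scl Y)"
  then obtain p q where p: "p \<in> polynomial_functions scl" "f = restrict p Y"
    and q: "q \<in> polynomial_functions scl" "g = restrict q Y"
    by auto
  have "\<forall>y\<in>Y. p y * q y = 0"
  proof
    fix y assume "y \<in> Y"
    then show "p y * q y = 0"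
      using fun_cong[OF 0, of y] by (simp add: p q)
  qed
  with assms(2)[OF p(1) q(1)]
  show "f = \<zero>\<^bsub>coordinate_ring scl Y\<^esub> \<or> g = \<zero>\<^bsub>coordinate_ring scl Y\<^esub>"
    by (auto simp: p q cong: restrict_cong)
qed

text \<open>Linear forms become polynomials of degree at most one in the parameter, and sums and
  products preserve polynomiality.\<close>

lemma polynomial_function_on_line:
  assumes "vector_space scl" "f \<in> polynomial_functions scl"
  shows "\<exists>p. \<forall>t. f (x + scl t y) = poly p t"
  using assms(2)
proof induction
  case (const c)
  show ?case by (rule exI[of _ "[:c:]"]) simp
next
  case (linear f)
  then interpret Vector_Spaces.linear scl "(*)" f .
  show ?case by (rule exI[of _ "[:f x, f y:]"]) (simp add: add scale)
next
  case (add f g)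
  then show ?case by (metis poly_add)
next
  case (mult f g)
  then show ?case by (metis poly_mult)
qed

text \<open>On the line through a point with \<open>f \<noteq> 0\<close> and a point with \<open>g \<noteq> 0\<close>, both functions are
  nonzero polynomials in the parameter.\<close>

lemma coordinate_ring_UNIV_domain:
  assumes "vector_space scl"
  shows "domain (coordinate_ring scl UNIV)"
proof (rule coordinate_ring_domain)
  interpret vector_space scl by fact
  fix f g
  assume fg: "f \<in> polynomial_functions scl" "g \<in> polynomial_functions scl"
    and 0: "\<forall>y\<in>UNIV. f y * g y = 0"
  show "(\<forall>y\<in>UNIV. f y = 0) \<or> (\<forall>y\<in>UNIV. g y = 0)"
  proof (rule ccontr)
    assume "\<not> ?thesis"
    then obtain v w where vw: "f v \<noteq> 0" "g w \<noteq> 0" by auto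
    obtain p q where p: "\<And>t. f (v + scl t (w - v)) = poly p t"
      and q: "\<And>t. g (v + scl t (w - v)) = poly q t"
      using polynomial_function_on_line[OF assms fg(1)] polynomial_function_on_line[OF assms fg(2)]
      by metis
    have "poly (p * q) t = 0" for t
      using 0 by (simp flip: p q)
    then have "p = 0 \<or> q = 0"
      using poly_all_0_iff_0[of "p * q"] by simp
    then show False
      using p[of 0] q[of 1] vw by auto
  qed
qed simp


section \<open>Irreducible closed sets\<close>

lemma topspace_zariski [simp]: "topspace (zariski scl) = UNIV"
proof -
  have "openin (zariski scl) UNIV"
    unfolding openin_zariski
    by (rule exI[of _ "{\<lambda>v. 1}"]) (auto intro: polynomial_functions.const)
  then show ?thesis
    using openin_subset by blast
qed

lemma openin_zariski_nonzero:
  "f \<in> polynomial_functions scl \<Longrightarrow> openin (zariski scl) {v. f v \<noteq> 0}"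
  unfolding openin_zariski by (rule exI[of _ "{f}"]) auto

lemma openin_subtopology_zariski_nonzero:
  "f \<in> polynomial_functions scl \<Longrightarrow> openin (subtopology (zariski scl) Y) {y \<in> Y. f y \<noteq> 0}"
  unfolding openin_subtopology using openin_zariski_nonzero by blast

text \<open>For disjoint sets, the complements of the ambient open sets would be closed and cover
  \<open>Y\<close>. Irreducibility would put \<open>Y\<close> inside one of them, making
  \<open>U\<close> or \<open>U'\<close> empty.\<close>

lemma irreducible_closed_open_Int:
  assumes "irreducible_closed scl Y"
    and "openin (subtopology (zariski scl) Y) U" "U \<noteq> {}"
    and "openin (subtopology (zariski scl) Y) U'" "U' \<noteq> {}"
  shows "U \<inter> U' \<noteq> {}"
proof
  assume disj: "U \<inter> U' = {}"
  obtain T T' where T: "openin (zariski scl) T" "U = T \<inter> Y"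
    and T': "openin (zariski scl) T'" "U' = T' \<inter> Y"
    using assms(2,4) by (auto simp: openin_subtopology)
  have "closedin (zariski scl) (- T)" "closedin (zariski scl) (- T')"
    using T(1) T'(1) by (auto simp: closedin_def Compl_eq_Diff_UNIV double_diff)
  moreover have "Y \<subseteq> - T \<union> - T'"
    using disj T(2) T'(2) by auto
  ultimately have "Y \<subseteq> - T \<or> Y \<subseteq> - T'"
    using assms(1) unfolding irreducible_closed_def by blast
  then show False
    using assms(3,5) T(2) T'(2) by auto
qed

text \<open>Otherwise the locus \<open>f \<noteq> 0\<close> in \<open>Y\<close> would be a nonempty
  open set missing \<open>U\<close>.\<close>

lemma irreducible_closed_polynomial_eq_0:
  assumes "irreducible_closed scl Y" "f \<in> polynomial_functions scl"
    and "openin (subtopology (zariski scl) Y) U" "U \<noteq> {}" "\<forall>y\<in>U. f y = 0"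
  shows "\<forall>y\<in>Y. f y = 0"
  using irreducible_closed_open_Int[OF assms(1) openin_subtopology_zariski_nonzero[OF assms(2)] _ assms(3,4)]
    assms(5) by blast

text \<open>If \<open>g\<close> is nonzero somewhere on \<open>Y\<close>, then \<open>f\<close>
  vanishes on the nonempty open locus \<open>g \<noteq> 0\<close>, hence on all of
  \<open>Y\<close>.\<close>

lemma irreducible_closed_coordinate_ring_domain:
  assumes "irreducible_closed scl Y"
  shows "domain (coordinate_ring scl Y)"
proof (rule coordinate_ring_domain)
  show "Y \<noteq> {}"
    using assms by (simp add: irreducible_closed_def)
next
  fix f g
  assume fg: "f \<in> polynomial_functions scl" "g \<in> polynomial_functions scl"
    and 0: "\<forall>y\<in>Y. f y * g y = 0"
  show "(\<forall>y\<in>Y. f y = 0) \<or> (\<forall>y\<in>Y. g y = 0)"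
    using irreducible_closed_polynomial_eq_0[OF assms fg(1) openin_subtopology_zariski_nonzero[OF fg(2)]] 0
    by auto
qed

text \<open>Near \<open>y\<close> the pulled-back function is a quotient \<open>a / b\<close>, so
  the nonvanishing locus of \<open>a\<close> in that neighbourhood is a suitable open set, and it
  contains \<open>y\<close>.\<close>

lemma regular_map_generically_nonzero:
  assumes "regular_map scl Y Y \<phi>" "f \<in> polynomial_functions scl" "y \<in> Y" "f (\<phi> y) \<noteq> 0"
  obtains U where "openin (subtopology (zariski scl) Y) U" "U \<noteq> {}" "\<forall>u\<in>U. f (\<phi> u) \<noteq> 0"
proof -
  obtain N a b where N: "openin (subtopology (zariski scl) Y) N" "y \<in> N"
    and a: "a \<in> polynomial_functions scl"
    and eq: "\<forall>u\<in>N. b u \<noteq> 0 \<and> f (\<phi> u) = a u / b u"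
    using assms unfolding regular_map_def regular_function_on_def by blast
  have sub: "N \<subseteq> Y"
    using openin_subset[OF N(1)] by simp
  show thesis
  proof (rule that)
    show "openin (subtopology (zariski scl) Y) (N \<inter> {u \<in> Y. a u \<noteq> 0})"
      using N(1) openin_subtopology_zariski_nonzero[OF a] by (rule openin_Int)
    show "N \<inter> {u \<in> Y. a u \<noteq> 0} \<noteq> {}"
      using N(2) sub eq assms(4) by auto
    show "\<forall>u\<in>N \<inter> {u \<in> Y. a u \<noteq> 0}. f (\<phi> u) \<noteq> 0"
      using eq by auto
  qed
qed

text \<open>Near \<open>x\<close> the pullback of \<open>f\<close> is \<open>a / b\<close>, so the
  generic identity becomes the polynomial equation \<open>a = f b\<close> on a nonempty open set. It
  extends to \<open>Y\<close> by density, and at \<open>x\<close> one may divide by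
  \<open>b\<close>.\<close>

lemma regular_map_generic_invariance:
  assumes irr: "irreducible_closed scl Y" and reg: "regular_map scl Y Y \<phi>"
    and f: "f \<in> polynomial_functions scl"
    and gen: "generically scl Y (\<lambda>y. f (\<phi> y) = f y)" and x: "x \<in> Y"
  shows "f (\<phi> x) = f x"
proof -
  obtain U where U: "openin (subtopology (zariski scl) Y) U" "U \<noteq> {}" "\<forall>y\<in>U. f (\<phi> y) = f y"
    using gen unfolding generically_def by blast
  obtain N a b where N: "openin (subtopology (zariski scl) Y) N" "x \<in> N"
    and ab: "a \<in> polynomial_functions scl" "b \<in> polynomial_functions scl"
    and eq: "\<forall>u\<in>N. b u \<noteq> 0 \<and> f (\<phi> u) = a u / b u"
    using reg f x unfolding regular_map_def regular_function_on_def by blast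
  have "\<forall>y\<in>Y. a y - f y * b y = 0"
  proof (rule irreducible_closed_polynomial_eq_0[OF irr])
    show "(\<lambda>y. a y - f y * b y) \<in> polynomial_functions scl"
      by (intro polynomial_functions_diff polynomial_functions.mult ab f)
    show "openin (subtopology (zariski scl) Y) (N \<inter> U)"
      using N(1) U(1) by (rule openin_Int)
    show "N \<inter> U \<noteq> {}"
      using irreducible_closed_open_Int[OF irr N(1) _ U(1,2)] N(2) by blast
    show "\<forall>y\<in>N \<inter> U. a y - f y * b y = 0"
      using U(3) eq by (auto simp: field_simps)
  qed
  then show ?thesis
    using eq N(2) x by (auto simp: field_simps)
qed

lemma invariant_field_iff:
  "r \<in> carrier (invariant_field scl Y S act) \<longleftrightarrow>
     r \<in> carrier (function_field scl Y) \<and>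
     (\<forall>a b s. (a, b) \<in> r \<longrightarrow> s \<in> S \<longrightarrow>
        generically scl Y (\<lambda>y. act s y \<in> Y \<and> b y \<noteq> 0 \<and> b (act s y) \<noteq> 0 \<and>
          a (act s y) / b (act s y) = a y / b y))"
  by (auto simp: invariant_field_def)

text \<open>A generic identity spreads over \<open>Y\<close> by density. Conversely, a pointwise
  identity yields the generic one for every representative, once its denominator is known to be
  nonzero at both \<open>y\<close> and \<open>act s y\<close> on a common open set.\<close>

lemma invariant_ring_eq_birational_invariant_ring:
  assumes irr: "irreducible_closed scl Y"
    and reg: "\<And>s. s \<in> S \<Longrightarrow> regular_automorphism scl Y (act s)"
  shows "invariant_ring scl Y S act = birational_invariant_ring scl Y S act"
proof -
  let ?R = "coordinate_ring scl Y"
  interpret domain ?R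
    using irr by (rule irreducible_closed_coordinate_ring_domain)
  have act_Y: "act s y \<in> Y" if "s \<in> S" "y \<in> Y" for s y
    using reg[OF that(1)] that(2) unfolding regular_automorphism_def regular_map_def by blast
  have "(\<forall>s\<in>S. \<forall>y\<in>Y. h (act s y) = h y) \<longleftrightarrow>
      fraction ?R h \<one>\<^bsub>?R\<^esub> \<in> carrier (invariant_field scl Y S act)"
    (is "?inv \<longleftrightarrow> ?frac") if h: "h \<in> carrier ?R" for h
  proof
    assume inv: ?inv
    have "generically scl Y (\<lambda>y. act s y \<in> Y \<and> b y \<noteq> 0 \<and> b (act s y) \<noteq> 0 \<and>
        a (act s y) / b (act s y) = a y / b y)"
      if ab: "(a, b) \<in> fraction ?R h \<one>\<^bsub>?R\<^esub>" and s: "s \<in> S" for a b s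
    proof -
      from ab obtain q where q: "q \<in> polynomial_functions scl" "b = restrict q Y"
        and nz: "b \<noteq> \<zero>\<^bsub>?R\<^esub>" and a: "a \<in> carrier ?R" "h \<otimes>\<^bsub>?R\<^esub> b = a \<otimes>\<^bsub>?R\<^esub> \<one>\<^bsub>?R\<^esub>"
        by (auto simp: fraction_def)
      have hb: "a y = h y * b y" if "y \<in> Y" for y
        using fun_cong[OF a(2), of y] that by simp
      from nz q(2) have "restrict q Y \<noteq> (\<lambda>v\<in>Y. 0)"
        by simp
      then obtain y where y: "y \<in> Y" "q y \<noteq> 0"
        by (metis restrict_ext)
      \<comment> \<open>The inverse \<open>\<psi>\<close> supplies the point
        \<open>\<psi> y\<close>, at which \<open>q\<close> composed with \<open>act s\<close> takes
        the nonzero value \<open>q y\<close>.\<close>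
      obtain \<psi> where "regular_map scl Y Y \<psi>" "\<forall>y\<in>Y. act s (\<psi> y) = y"
        and reg': "regular_map scl Y Y (act s)"
        using reg[OF s] unfolding regular_automorphism_def by blast
      then have "\<psi> y \<in> Y" "q (act s (\<psi> y)) \<noteq> 0"
        using y by (auto simp: regular_map_def)
      then obtain U where U: "openin (subtopology (zariski scl) Y) U" "U \<noteq> {}"
        "\<forall>u\<in>U. q (act s u) \<noteq> 0"
        using regular_map_generically_nonzero[OF reg' q(1)] by blast
      let ?N = "{y \<in> Y. q y \<noteq> 0}"
      have N: "openin (subtopology (zariski scl) Y) ?N"
        by (rule openin_subtopology_zariski_nonzero[OF q(1)])
      show ?thesis
        unfolding generically_def
      proof (intro exI conjI)
        show "openin (subtopology (zariski scl) Y) (?N \<inter> U)"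
          using N U(1) by (rule openin_Int)
        show "?N \<inter> U \<noteq> {}"
          using irreducible_closed_open_Int[OF irr N _ U(1,2)] y by blast
        show "\<forall>y\<in>?N \<inter> U. act s y \<in> Y \<and> b y \<noteq> 0 \<and> b (act s y) \<noteq> 0 \<and>
            a (act s y) / b (act s y) = a y / b y"
          using U(3) act_Y[OF s] inv s by (auto simp: hb q(2))
      qed
    qed
    moreover have "fraction ?R h \<one>\<^bsub>?R\<^esub> \<in> carrier (fraction_field ?R)"
      unfolding fraction_field_def using h one_closed one_not_zero by auto
    ultimately show ?frac
      unfolding invariant_field_iff by blast
  next
    assume frac: ?frac
    obtain f where f: "f \<in> polynomial_functions scl" "h = restrict f Y"
      using h by auto
    show ?inv
    proof (intro ballI)
      fix s y assume s: "s \<in> S" and y: "y \<in> Y"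
      have "(h, \<one>\<^bsub>?R\<^esub>) \<in> fraction ?R h \<one>\<^bsub>?R\<^esub>"
        using h one_closed one_not_zero by (simp add: fraction_def)
      with frac s have "generically scl Y (\<lambda>y. act s y \<in> Y \<and> \<one>\<^bsub>?R\<^esub> y \<noteq> 0 \<and>
          \<one>\<^bsub>?R\<^esub> (act s y) \<noteq> 0 \<and> h (act s y) / \<one>\<^bsub>?R\<^esub> (act s y) = h y / \<one>\<^bsub>?R\<^esub> y)"
        unfolding invariant_field_iff by blast
      then obtain U where U: "openin (subtopology (zariski scl) Y) U" "U \<noteq> {}"
        "\<forall>y\<in>U. act s y \<in> Y \<and> h (act s y) / \<one>\<^bsub>?R\<^esub> (act s y) = h y / \<one>\<^bsub>?R\<^esub> y"
        unfolding generically_def by blast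
      \<comment> \<open>Both \<open>h\<close> and the unit are \<open>undefined\<close> off
        \<open>Y\<close>, so passing to the polynomial \<open>f\<close> requires \<open>y\<close>
        and \<open>act s y\<close> to lie in \<open>Y\<close>.\<close>
      have "f (act s y) = f y" if "y \<in> U" for y
      proof -
        have "y \<in> Y" "act s y \<in> Y"
          using openin_subset[OF U(1)] U(3) that by auto
        then show ?thesis
          using U(3) that f(2) by force
      qed
      then have "generically scl Y (\<lambda>y. f (act s y) = f y)"
        unfolding generically_def using U(1,2) by blast
      then have "f (act s y) = f y"
        using reg[OF s] f(1) y
        by (intro regular_map_generic_invariance[OF irr]) (auto simp: regular_automorphism_def)
      then show "h (act s y) = h y"
        using f(2) y act_Y[OF s] by simp
    qed
  qed
  then have "{h \<in> carrier ?R. \<forall>s\<in>S. \<forall>y\<in>Y. h (act s y) = h y} =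
      {h \<in> carrier ?R. fraction ?R h \<one>\<^bsub>?R\<^esub> \<in> carrier (invariant_field scl Y S act)}"
    by blast
  then show ?thesis
    unfolding invariant_ring_def birational_invariant_ring_def by (simp only:)
qed

section \<open>Pure tensors\<close>

lemma frag_extend_zero_fun: "frag_extend (\<lambda>x. 0) c = 0"
  by (simp add: frag_extend_def)

text \<open>The product of \<open>pair_ring\<close> nests one \<open>frag_extend\<close> in the
  function argument of another; distributivity in the second factor therefore needs additivity in
  the function.\<close>

lemma frag_extend_add_fun:
  "frag_extend (\<lambda>x. f x + g x) c = frag_extend f c + frag_extend g c"
  by (simp add: frag_extend_def frag_cmul_distrib2 sum.distrib)

lemma frag_extend_diff_fun:
  "frag_extend (\<lambda>x. f x - g x) c = frag_extend f c - frag_extend g c"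
  using frag_extend_add_fun[of "\<lambda>x. f x - g x" g c] by (simp add: algebra_simps)

lemma pair_ring_simps [simp]:
  "carrier (pair_ring A B) = {c. Poly_Mapping.keys c \<subseteq> carrier A \<times> carrier B}"
  "\<one>\<^bsub>pair_ring A B\<^esub> = frag_of (\<one>\<^bsub>A\<^esub>, \<one>\<^bsub>B\<^esub>)"
  "\<zero>\<^bsub>pair_ring A B\<^esub> = 0"
  "c \<oplus>\<^bsub>pair_ring A B\<^esub> d = c + d"
  by (simp_all add: pair_ring_def)

lemma pair_ring_mult_diff:
  "(c - c') \<otimes>\<^bsub>pair_ring A B\<^esub> d = c \<otimes>\<^bsub>pair_ring A B\<^esub> d - c' \<otimes>\<^bsub>pair_ring A B\<^esub> d"
  "d \<otimes>\<^bsub>pair_ring A B\<^esub> (c - c') = d \<otimes>\<^bsub>pair_ring A B\<^esub> c - d \<otimes>\<^bsub>pair_ring A B\<^esub> c'"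
  by (simp_all add: pair_ring_def frag_extend_diff frag_extend_diff_fun case_prod_unfold)

lemma pair_ring_mult_add:
  "(c + c') \<otimes>\<^bsub>pair_ring A B\<^esub> d = c \<otimes>\<^bsub>pair_ring A B\<^esub> d + c' \<otimes>\<^bsub>pair_ring A B\<^esub> d"
  "d \<otimes>\<^bsub>pair_ring A B\<^esub> (c + c') = d \<otimes>\<^bsub>pair_ring A B\<^esub> c + d \<otimes>\<^bsub>pair_ring A B\<^esub> c'"
  by (simp_all add: pair_ring_def frag_extend_add frag_extend_add_fun case_prod_unfold)

lemma pair_ring_mult_zero [simp]:
  "0 \<otimes>\<^bsub>pair_ring A B\<^esub> d = 0"
  "d \<otimes>\<^bsub>pair_ring A B\<^esub> 0 = 0"
  by (simp_all add: pair_ring_def frag_extend_zero_fun case_prod_unfold)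

lemma pair_ring_mult_frag_of [simp]:
  "frag_of (a, b) \<otimes>\<^bsub>pair_ring A B\<^esub> frag_of (a', b') = frag_of (a \<otimes>\<^bsub>A\<^esub> a', b \<otimes>\<^bsub>B\<^esub> b')"
  by (simp add: pair_ring_def)

lemma pair_ring_minus_closed:
  "c \<in> carrier (pair_ring A B) \<Longrightarrow> d \<in> carrier (pair_ring A B) \<Longrightarrow> c - d \<in> carrier (pair_ring A B)"
  using keys_diff[of c d] by auto

text \<open>By biadditivity, closure, associativity and the unit laws reduce to generators, where
  they are those of \<open>A\<close> and \<open>B\<close>. \<open>frag_induction\<close> builds
  formal sums by differences, hence the use of \<open>pair_ring_mult_diff\<close>.\<close>

lemma pair_ring_ring:
  assumes "Group.monoid A" "Group.monoid B"
  shows "ring (pair_ring A B)"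
proof (rule ringI)
  interpret A: Group.monoid A by fact
  interpret B: Group.monoid B by fact
  let ?P = "pair_ring A B"
  show "abelian_group ?P"
  proof (rule abelian_groupI)
    fix c assume "c \<in> carrier ?P"
    then have "0 - c \<in> carrier ?P"
      by (intro pair_ring_minus_closed) auto
    then show "\<exists>d\<in>carrier ?P. d \<oplus>\<^bsub>?P\<^esub> c = \<zero>\<^bsub>?P\<^esub>"
      by (rule rev_bexI) simp
  next
    fix c d assume "c \<in> carrier ?P" "d \<in> carrier ?P"
    then show "c \<oplus>\<^bsub>?P\<^esub> d \<in> carrier ?P"
      using keys_add[of c d] by auto
  qed (auto simp: add_ac)
  show "Group.monoid ?P"
  proof (rule monoidI)
    fix c d assume c: "c \<in> carrier ?P" and d: "d \<in> carrier ?P"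
    from c have "Poly_Mapping.keys c \<subseteq> carrier A \<times> carrier B" by simp
    then show "c \<otimes>\<^bsub>?P\<^esub> d \<in> carrier ?P"
    proof (induction c rule: frag_induction)
      case (one x)
      from d have "Poly_Mapping.keys d \<subseteq> carrier A \<times> carrier B" by simp
      then show ?case
      proof (induction d rule: frag_induction)
        case (one y)
        with \<open>x \<in> _\<close> show ?case by (cases x; cases y) (simp add: keys_frag_of)
      next
        case (diff d d')
        then show ?case unfolding pair_ring_mult_diff by (rule pair_ring_minus_closed)
      qed simp
    next
      case (diff c c')
      then show ?case unfolding pair_ring_mult_diff by (rule pair_ring_minus_closed)
    qed simp
  next
    fix c d e assume c: "c \<in> carrier ?P" and d: "d \<in> carrier ?P" and e: "e \<in> carrier ?P"
    from c have "Poly_Mapping.keys c \<subseteq> carrier A \<times> carrier B" by simp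
    then show "c \<otimes>\<^bsub>?P\<^esub> d \<otimes>\<^bsub>?P\<^esub> e = c \<otimes>\<^bsub>?P\<^esub> (d \<otimes>\<^bsub>?P\<^esub> e)"
    proof (induction c rule: frag_induction)
      case (one x)
      from d have "Poly_Mapping.keys d \<subseteq> carrier A \<times> carrier B" by simp
      then show ?case
      proof (induction d rule: frag_induction)
        case (one y)
        from e have "Poly_Mapping.keys e \<subseteq> carrier A \<times> carrier B" by simp
        then show ?case
        proof (induction e rule: frag_induction)
          case (one z)
          with \<open>x \<in> _\<close> \<open>y \<in> _\<close> show ?case
            by (cases x; cases y; cases z) (simp add: A.m_assoc B.m_assoc)
        qed (simp_all add: pair_ring_mult_diff)
      qed (simp_all add: pair_ring_mult_diff)
    qed (simp_all add: pair_ring_mult_diff)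
  next
    fix c assume "c \<in> carrier ?P"
    then have c: "Poly_Mapping.keys c \<subseteq> carrier A \<times> carrier B" by simp
    from c show "\<one>\<^bsub>?P\<^esub> \<otimes>\<^bsub>?P\<^esub> c = c"
      by (induction c rule: frag_induction) (auto simp: pair_ring_mult_diff)
    from c show "c \<otimes>\<^bsub>?P\<^esub> \<one>\<^bsub>?P\<^esub> = c"
      by (induction c rule: frag_induction) (auto simp: pair_ring_mult_diff)
  qed (simp add: keys_frag_of)
qed (simp_all add: pair_ring_mult_add)

lemma tensor_relations_closed:
  assumes "ring A" "ring B" "\<alpha> ` carrier R \<subseteq> carrier A" "\<beta> ` carrier R \<subseteq> carrier B"
  shows "tensor_relations R A B \<alpha> \<beta> \<subseteq> carrier (pair_ring A B)"
proof -
  interpret A: ring A by fact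
  interpret B: ring B by fact
  have "frag_of (a, b) \<in> carrier (pair_ring A B)" if "a \<in> carrier A" "b \<in> carrier B" for a b
    using that by (simp add: keys_frag_of)
  moreover have "\<alpha> r \<in> carrier A" "\<beta> r \<in> carrier B" if "r \<in> carrier R" for r
    using that assms(3,4) by auto
  ultimately show ?thesis
    unfolding tensor_relations_def
    by (auto intro!: pair_ring_minus_closed simp del: pair_ring_simps)
qed

text \<open>Separates the algebra of a quotient of a tensor product from the geometry; it is applied
  below with \<open>I\<close> equal to \<open>\<mm>\<close>.\<close>

locale tensor_quotient =
  A: ring A + B: ring B + I: ideal I "tensor_ring R A B \<alpha> \<beta>"
  for R :: "('r, 'e) ring_scheme" and A :: "('a, 'c) ring_scheme" and B :: "('b, 'd) ring_scheme"
    and \<alpha> :: "'r \<Rightarrow> 'a" and \<beta> :: "'r \<Rightarrow> 'b" and I +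
  assumes \<alpha>_closed: "\<alpha> ` carrier R \<subseteq> carrier A" and \<beta>_closed: "\<beta> ` carrier R \<subseteq> carrier B"
begin

definition tensor_class :: "'a \<Rightarrow> 'b \<Rightarrow> (('a \<times> 'b) \<Rightarrow>\<^sub>0 int) set set" where
  "tensor_class a b = I +>\<^bsub>tensor_ring R A B \<alpha> \<beta>\<^esub> pure_tensor R A B \<alpha> \<beta> a b"

definition residue_ring :: "(('a \<times> 'b) \<Rightarrow>\<^sub>0 int) set set ring" where
  "residue_ring = tensor_ring R A B \<alpha> \<beta> Quot I"

sublocale P: ring "pair_ring A B"
  by (rule pair_ring_ring) unfold_locales

sublocale J: ideal "tensor_ideal R A B \<alpha> \<beta>" "pair_ring A B"
  unfolding tensor_ideal_def
  by (rule P.genideal_ideal) (rule tensor_relations_closed[OF A.ring_axioms B.ring_axioms \<alpha>_closed \<beta>_closed])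

sublocale Q: ring residue_ring
  unfolding residue_ring_def by (rule I.quotient_is_ring)

lemma tensor_ring_hom: "(+>\<^bsub>pair_ring A B\<^esub>) (tensor_ideal R A B \<alpha> \<beta>)
    \<in> ring_hom (pair_ring A B) (tensor_ring R A B \<alpha> \<beta>)"
  unfolding tensor_ring_def by (rule J.rcos_ring_hom)

lemma frag_of_closed: "a \<in> carrier A \<Longrightarrow> b \<in> carrier B \<Longrightarrow> frag_of (a, b) \<in> carrier (pair_ring A B)"
  by (simp add: keys_frag_of)

lemma pure_tensor_closed:
  "a \<in> carrier A \<Longrightarrow> b \<in> carrier B \<Longrightarrow> pure_tensor R A B \<alpha> \<beta> a b \<in> carrier (tensor_ring R A B \<alpha> \<beta>)"
  unfolding pure_tensor_def by (rule ring_hom_closed[OF tensor_ring_hom frag_of_closed])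

text \<open>The composite of both quotient maps, so that identities between classes can be checked
  on formal sums of pairs.\<close>

definition residue_map :: "(('a \<times> 'b) \<Rightarrow>\<^sub>0 int) \<Rightarrow> (('a \<times> 'b) \<Rightarrow>\<^sub>0 int) set set" where
  "residue_map c = I +>\<^bsub>tensor_ring R A B \<alpha> \<beta>\<^esub> (tensor_ideal R A B \<alpha> \<beta> +>\<^bsub>pair_ring A B\<^esub> c)"

lemma residue_map_hom: "residue_map \<in> ring_hom (pair_ring A B) residue_ring"
  using ring_hom_trans[OF tensor_ring_hom I.rcos_ring_hom]
  by (simp add: residue_map_def[abs_def] residue_ring_def comp_def)

sublocale residue_map: ring_hom_ring "pair_ring A B" residue_ring residue_map
  by (rule ring_hom_ringI2[OF P.ring_axioms Q.ring_axioms residue_map_hom])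

lemma tensor_class_eq: "tensor_class a b = residue_map (frag_of (a, b))"
  by (simp add: tensor_class_def residue_map_def pure_tensor_def)

lemma tensor_class_closed [simp]:
  "a \<in> carrier A \<Longrightarrow> b \<in> carrier B \<Longrightarrow> tensor_class a b \<in> carrier residue_ring"
  unfolding tensor_class_eq by (intro residue_map.hom_closed frag_of_closed)

lemma tensor_class_one [simp]: "tensor_class \<one>\<^bsub>A\<^esub> \<one>\<^bsub>B\<^esub> = \<one>\<^bsub>residue_ring\<^esub>"
  unfolding tensor_class_eq using residue_map.hom_one by simp

lemma tensor_class_mult:
  assumes "a \<in> carrier A" "b \<in> carrier B" "a' \<in> carrier A" "b' \<in> carrier B"
  shows "tensor_class a b \<otimes>\<^bsub>residue_ring\<^esub> tensor_class a' b' =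
    tensor_class (a \<otimes>\<^bsub>A\<^esub> a') (b \<otimes>\<^bsub>B\<^esub> b')"
  unfolding tensor_class_eq
  using residue_map.hom_mult[OF frag_of_closed[OF assms(1,2)] frag_of_closed[OF assms(3,4)]] by simp

lemma residue_map_relation:
  assumes "c - d \<in> tensor_relations R A B \<alpha> \<beta>"
    "c \<in> carrier (pair_ring A B)" "d \<in> carrier (pair_ring A B)"
  shows "residue_map c = residue_map d"
proof -
  let ?J = "tensor_ideal R A B \<alpha> \<beta>" and ?P = "pair_ring A B"
  have "c - d \<in> ?J"
    using assms(1) P.genideal_self[OF tensor_relations_closed[OF A.ring_axioms B.ring_axioms \<alpha>_closed \<beta>_closed]]
    unfolding tensor_ideal_def by blast
  \<comment> \<open>The relations use subtraction of formal sums, the coset criterion uses the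
    subtraction of the ring; adding \<open>d\<close> to either gives \<open>c\<close>.\<close>
  moreover have "c - d = c \<ominus>\<^bsub>?P\<^esub> d"
  proof -
    have "(c \<ominus>\<^bsub>?P\<^esub> d) \<oplus>\<^bsub>?P\<^esub> d = c"
      using assms(2,3) by (simp only: P.minus_eq P.a_assoc P.l_neg P.r_zero P.a_inv_closed)
    then show ?thesis
      by (simp add: algebra_simps)
  qed
  ultimately have "?J +>\<^bsub>?P\<^esub> c = ?J +>\<^bsub>?P\<^esub> d"
    using P.quotient_eq_iff_same_a_r_cos[OF J.is_ideal assms(2,3)] by simp
  then show ?thesis
    by (simp add: residue_map_def)
qed

lemma tensor_class_add_left:
  assumes "a \<in> carrier A" "a' \<in> carrier A" "b \<in> carrier B"
  shows "tensor_class (a \<oplus>\<^bsub>A\<^esub> a') b = tensor_class a b \<oplus>\<^bsub>residue_ring\<^esub> tensor_class a' b"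
proof -
  have "residue_map (frag_of (a \<oplus>\<^bsub>A\<^esub> a', b)) = residue_map (frag_of (a, b) \<oplus>\<^bsub>pair_ring A B\<^esub> frag_of (a', b))"
  proof (rule residue_map_relation)
    show "frag_of (a \<oplus>\<^bsub>A\<^esub> a', b) - (frag_of (a, b) \<oplus>\<^bsub>pair_ring A B\<^esub> frag_of (a', b))
        \<in> tensor_relations R A B \<alpha> \<beta>"
      using assms unfolding tensor_relations_def by (auto simp: diff_diff_add[symmetric])
  qed (use assms in \<open>auto intro!: P.a_closed frag_of_closed simp del: pair_ring_simps\<close>)
  then show ?thesis
    unfolding tensor_class_eq
    using residue_map.hom_add[OF frag_of_closed[OF assms(1,3)] frag_of_closed[OF assms(2,3)]] by simp
qed

lemma tensor_class_add_right:
  assumes "a \<in> carrier A" "b \<in> carrier B" "b' \<in> carrier B"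
  shows "tensor_class a (b \<oplus>\<^bsub>B\<^esub> b') = tensor_class a b \<oplus>\<^bsub>residue_ring\<^esub> tensor_class a b'"
proof -
  have "residue_map (frag_of (a, b \<oplus>\<^bsub>B\<^esub> b')) = residue_map (frag_of (a, b) \<oplus>\<^bsub>pair_ring A B\<^esub> frag_of (a, b'))"
  proof (rule residue_map_relation)
    show "frag_of (a, b \<oplus>\<^bsub>B\<^esub> b') - (frag_of (a, b) \<oplus>\<^bsub>pair_ring A B\<^esub> frag_of (a, b'))
        \<in> tensor_relations R A B \<alpha> \<beta>"
      using assms unfolding tensor_relations_def by (auto simp: diff_diff_add[symmetric])
  qed (use assms in \<open>auto intro!: P.a_closed frag_of_closed simp del: pair_ring_simps\<close>)
  then show ?thesis
    unfolding tensor_class_eq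
    using residue_map.hom_add[OF frag_of_closed[OF assms(1,2)] frag_of_closed[OF assms(1,3)]] by simp
qed

lemma tensor_class_balanced:
  assumes "r \<in> carrier R" "a \<in> carrier A" "b \<in> carrier B"
  shows "tensor_class (\<alpha> r \<otimes>\<^bsub>A\<^esub> a) b = tensor_class a (\<beta> r \<otimes>\<^bsub>B\<^esub> b)"
  unfolding tensor_class_eq
proof (rule residue_map_relation)
  show "frag_of (\<alpha> r \<otimes>\<^bsub>A\<^esub> a, b) - frag_of (a, \<beta> r \<otimes>\<^bsub>B\<^esub> b) \<in> tensor_relations R A B \<alpha> \<beta>"
    using assms unfolding tensor_relations_def by auto
  have "\<alpha> r \<in> carrier A" "\<beta> r \<in> carrier B"
    using assms(1) \<alpha>_closed \<beta>_closed by auto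
  then show "frag_of (\<alpha> r \<otimes>\<^bsub>A\<^esub> a, b) \<in> carrier (pair_ring A B)"
    "frag_of (a, \<beta> r \<otimes>\<^bsub>B\<^esub> b) \<in> carrier (pair_ring A B)"
    using assms by (auto intro!: frag_of_closed simp del: pair_ring_simps)
qed

lemma left_class_hom: "(\<lambda>a. tensor_class a \<one>\<^bsub>B\<^esub>) \<in> ring_hom A residue_ring"
  by (rule ring_hom_memI) (simp_all add: tensor_class_mult tensor_class_add_left)

lemma right_class_hom: "tensor_class \<one>\<^bsub>A\<^esub> \<in> ring_hom B residue_ring"
  by (rule ring_hom_memI) (simp_all add: tensor_class_mult tensor_class_add_right)

text \<open>Balancing \<open>r\<close> across the pair of units. For invariant functions this is the
  compatibility of the maps from \<open>\<complex>[V]\<close> and \<open>K\<close> over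
  \<open>\<complex>[V]\<^sup>G\<close>.\<close>

lemma left_class_eq_right_class:
  assumes "r \<in> carrier R"
  shows "tensor_class (\<alpha> r) \<one>\<^bsub>B\<^esub> = tensor_class \<one>\<^bsub>A\<^esub> (\<beta> r)"
proof -
  have "\<alpha> r \<in> carrier A" "\<beta> r \<in> carrier B"
    using assms \<alpha>_closed \<beta>_closed by auto
  then show ?thesis
    using tensor_class_balanced[OF assms A.one_closed B.one_closed] by simp
qed

lemma left_class_eq_zero_iff:
  assumes "a \<in> carrier A"
  shows "tensor_class a \<one>\<^bsub>B\<^esub> = \<zero>\<^bsub>residue_ring\<^esub> \<longleftrightarrow> pure_tensor R A B \<alpha> \<beta> a \<one>\<^bsub>B\<^esub> \<in> I"
proof -
  have "pure_tensor R A B \<alpha> \<beta> a \<one>\<^bsub>B\<^esub> \<in> carrier (tensor_ring R A B \<alpha> \<beta>)"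
    using assms by (simp add: pure_tensor_closed)
  then show ?thesis
    unfolding tensor_class_def residue_ring_def
    by (metis (no_types, lifting) FactRing_def I.a_rcos_zero I.is_ideal I.rcos_const_imp_mem ring.simps(1))
qed

end


section \<open>Restriction of functions to an extension subvariety\<close>

text \<open>The Galois restriction property supplies a birational action, whereas the Chevalley
  property demands a regular one. The equivalence is therefore stated under regularity, and again
  for the given birational action with \<open>\<complex>[Y] \<inter> \<complex>(Y)\<^sup>W\<close>
  as the target.\<close>

theorem proposition4:
  fixes scl :: "complex \<Rightarrow> 'v::ab_group_add \<Rightarrow> 'v"
    and Basis :: "'v set"
    and G :: "(complex^'m^'m) set"
    and \<rho> :: "complex^'m^'m \<Rightarrow> 'v \<Rightarrow> 'v"
    and K :: "'k ring"
    and \<iota> :: "(('v \<Rightarrow> complex) \<times> ('v \<Rightarrow> complex)) set \<Rightarrow> 'k"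
    and \<mm> :: "((('v \<Rightarrow> complex) \<times> 'k) \<Rightarrow>\<^sub>0 int) set set"
    and Y :: "'v set"
    and W :: "'w monoid"
    and \<phi> :: "'w \<Rightarrow> 'v \<Rightarrow> 'v"
  assumes V: "finite_dimensional_vector_space scl Basis"
    and G: "reductive_group G"
    and rep: "rational_representation scl G \<rho>"
    and Frac: "carrier (invariant_field scl UNIV G \<rho>) =
      {fraction (coordinate_ring scl UNIV) a b | a b.
         a \<in> carrier (invariant_ring scl UNIV G \<rho>) \<and>
         b \<in> carrier (invariant_ring scl UNIV G \<rho>) \<and> b \<noteq> \<zero>\<^bsub>coordinate_ring scl UNIV\<^esub>}"
    and incl: "\<iota> \<in> ring_hom (invariant_field scl UNIV G \<rho>) K"
    and K: "algebraic_closure K (\<iota> ` carrier (invariant_field scl UNIV G \<rho>))"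
    and p: "maximalideal \<mm> (extension_ring scl G \<rho> K \<iota>)"
    and Y: "is_extension_subvariety scl G \<rho> K \<iota> \<mm> Y"
    and Galois: "galois_restriction_property scl G \<rho> Y W \<phi>"
  shows
    "(faithful_regular_action scl Y W \<phi> \<longrightarrow>
        (chevalley_restriction_property scl G \<rho> Y W \<phi> \<longleftrightarrow>
         embedded_coordinate_ring scl G \<rho> K \<iota> \<mm>
             \<inter> \<iota> ` carrier (invariant_field scl UNIV G \<rho>)
           = invariant_inclusion scl \<iota> ` carrier (invariant_ring scl UNIV G \<rho>))) \<and>
     ((\<lambda>f. restrict f Y) \<in> ring_iso (invariant_ring scl UNIV G \<rho>)
          (birational_invariant_ring scl Y (carrier W) \<phi>) \<longleftrightarrow>
         embedded_coordinate_ring scl G \<rho> K \<iota> \<mm>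
             \<inter> \<iota> ` carrier (invariant_field scl UNIV G \<rho>)
           = invariant_inclusion scl \<iota> ` carrier (invariant_ring scl UNIV G \<rho>))"
proof -
  let ?A = "invariant_ring scl UNIV G \<rho>"
  let ?B = "coordinate_ring scl UNIV"
  let ?R = "coordinate_ring scl Y"
  let ?F = "invariant_field scl UNIV G \<rho>"
  let ?FW = "invariant_field scl Y (carrier W) \<phi>"
  let ?BW = "birational_invariant_ring scl Y (carrier W) \<phi>"
  let ?j = "invariant_inclusion scl \<iota>"
  let ?E = "embedded_coordinate_ring scl G \<rho> K \<iota> \<mm>"
  let ?res = "restrict_rational scl Y"
  let ?P = "polynomial_functions scl"
  have irr: "irreducible_closed scl Y"
    using Galois by (simp add: galois_restriction_property_def)
  interpret V: finite_dimensional_vector_space scl Basis by (rule V)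
  interpret B: domain ?B by (rule coordinate_ring_UNIV_domain) unfold_locales
  interpret R: domain ?R using irr by (rule irreducible_closed_coordinate_ring_domain)
  interpret KC: algebraic_closure K "\<iota> ` carrier ?F" by (rule K)
  have res_iso: "?res \<in> ring_iso ?F ?FW"
    using Galois by (simp add: galois_restriction_property_def)
  then have res_closed: "?res r \<in> carrier ?FW" if "r \<in> carrier ?F" for r
    using that by (rule ring_iso_memE(1))
  have res_inj: "r = r'" if "?res r = ?res r'" "r \<in> carrier ?F" "r' \<in> carrier ?F" for r r'
    using ring_iso_memE(5)[OF res_iso] that by (auto simp: bij_betw_def inj_on_def)
  have res_surj: "\<exists>r\<in>carrier ?F. ?res r = z" if "z \<in> carrier ?FW" for z
    using that unfolding bij_betw_imp_surj_on[OF ring_iso_memE(5)[OF res_iso], symmetric] by blast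

  \<comment> \<open>Invariant functions and their fractions inside \<open>K\<close>\<close>
  have [simp]: "restrict f UNIV = f" for f :: "'v \<Rightarrow> complex"
    by (simp add: restrict_def)
  have carB: "carrier ?B = ?P"
    by simp
  have A_sub: "carrier ?A \<subseteq> ?P"
    by (auto simp: invariant_ring_def)
  have carA: "f \<in> carrier ?A \<Longrightarrow> f \<in> carrier ?B" for f
    using A_sub carB by blast
  have oneA: "\<one>\<^bsub>?B\<^esub> \<in> carrier ?A"
    by (auto simp: invariant_ring_def polynomial_functions.const)
  have FI: "fraction ?B a b \<in> carrier ?F"
    if "a \<in> carrier ?A" "b \<in> carrier ?A" "b \<noteq> \<zero>\<^bsub>?B\<^esub>" for a b
    unfolding Frac using that by blast
  have FE: "\<exists>a b. r = fraction ?B a b \<and> a \<in> carrier ?A \<and> b \<in> carrier ?A \<and> b \<noteq> \<zero>\<^bsub>?B\<^esub>"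
    if "r \<in> carrier ?F" for r
    using that unfolding Frac by blast
  have incl_mult: "\<iota> r \<otimes>\<^bsub>K\<^esub> \<iota> r' = \<iota> (r \<otimes>\<^bsub>fraction_field ?B\<^esub> r')"
    if "r \<in> carrier ?F" "r' \<in> carrier ?F" for r r'
    using ring_hom_mult[OF incl that] by (simp add: invariant_field_def)
  have incl_one: "?j \<one>\<^bsub>?B\<^esub> = \<one>\<^bsub>K\<^esub>"
    using ring_hom_one[OF incl]
    by (simp add: invariant_inclusion_def invariant_field_def fraction_field_def)
  have j_closed: "?j a \<in> carrier K" if "a \<in> carrier ?A" for a
    unfolding invariant_inclusion_def
    using that by (intro ring_hom_closed[OF incl] FI oneA B.one_not_zero)
  have incl_fraction: "\<iota> (fraction ?B a b) \<otimes>\<^bsub>K\<^esub> ?j b = ?j a"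
    if "a \<in> carrier ?A" "b \<in> carrier ?A" "b \<noteq> \<zero>\<^bsub>?B\<^esub>" for a b
  proof -
    have "\<iota> (fraction ?B a b) \<otimes>\<^bsub>K\<^esub> ?j b =
        \<iota> (fraction ?B a b \<otimes>\<^bsub>fraction_field ?B\<^esub> fraction ?B b \<one>\<^bsub>?B\<^esub>)"
      unfolding invariant_inclusion_def using that
      by (intro incl_mult FI oneA B.one_not_zero)
    also have "\<dots> = ?j a"
      unfolding invariant_inclusion_def using that carA
      by (subst B.fraction_mult_denominator) auto
    finally show ?thesis .
  qed
  \<comment> \<open>The fraction \<open>1 / b\<close> is invariant and maps to an inverse of
    \<open>?j b\<close>, so \<open>?j b = 0\<close> would force \<open>1 = 0\<close> in
    \<open>K\<close>.\<close>
  have j_nonzero: "?j b \<noteq> \<zero>\<^bsub>K\<^esub>" if "b \<in> carrier ?A" "b \<noteq> \<zero>\<^bsub>?B\<^esub>" for b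
  proof
    assume 0: "?j b = \<zero>\<^bsub>K\<^esub>"
    have "\<iota> (fraction ?B \<one>\<^bsub>?B\<^esub> b) \<in> carrier K"
      using that by (intro ring_hom_closed[OF incl] FI oneA)
    then show False
      using incl_fraction[OF oneA that] 0 incl_one KC.one_not_zero by simp
  qed

  \<comment> \<open>The residue ring at \<open>\<mm>\<close>\<close>
  interpret M: maximalideal \<mm> "tensor_ring ?A ?B K id ?j"
    using p by (simp add: extension_ring_def)
  interpret T: tensor_quotient ?A ?B K id ?j \<mm>
    by unfold_locales (use carA j_closed in \<open>auto simp del: coordinate_ring_simps\<close>)
  let ?Q = T.residue_ring
  \<comment> \<open>Functions and elements of \<open>K\<close> are compared inside the residue ring:
    \<open>e\<close> will have the functions vanishing on \<open>Y\<close> as kernel, and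
    \<open>u\<close> will be injective.\<close>
  define e where "e f = T.tensor_class f \<one>\<^bsub>K\<^esub>" for f
  define u where "u c = T.tensor_class \<one>\<^bsub>?B\<^esub> c" for c
  have e_hom: "e \<in> ring_hom ?B ?Q"
    unfolding e_def by (rule T.left_class_hom)
  have u_hom: "u \<in> ring_hom K ?Q"
    unfolding u_def[abs_def] by (rule T.right_class_hom)
  interpret e: ring_hom_ring ?B ?Q e
    by (rule ring_hom_ringI2[OF B.ring_axioms T.Q.ring_axioms e_hom])
  interpret u: ring_hom_ring K ?Q u
    by (rule ring_hom_ringI2[OF KC.ring_axioms T.Q.ring_axioms u_hom])
  have eu: "e a = u (?j a)" if "a \<in> carrier ?A" for a
    using T.left_class_eq_right_class[OF that] by (simp add: e_def u_def)
  have e_zero: "e f = \<zero>\<^bsub>?Q\<^esub> \<longleftrightarrow> (\<forall>y\<in>Y. f y = 0)" if "f \<in> ?P" for f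
  proof -
    have "e f = \<zero>\<^bsub>?Q\<^esub> \<longleftrightarrow> extension_tensor scl G \<rho> K \<iota> f \<one>\<^bsub>K\<^esub> \<in> \<mm>"
      unfolding e_def extension_tensor_def
      using that by (intro T.left_class_eq_zero_iff) (simp add: carB del: coordinate_ring_simps)
    then show ?thesis
      using Y that unfolding is_extension_subvariety_def by blast
  qed
  have e_eq: "e f = e g \<longleftrightarrow> (\<forall>y\<in>Y. f y = g y)" if "f \<in> ?P" "g \<in> ?P" for f g
  proof -
    let ?d = "\<lambda>v. f v - g v"
    have d: "?d \<in> ?P" using that by (rule polynomial_functions_diff)
    have car: "?d \<in> carrier ?B" "g \<in> carrier ?B"
      unfolding carB by (fact d that)+
    have "f = ?d \<oplus>\<^bsub>?B\<^esub> g" by auto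
    then have "e f = e ?d \<oplus>\<^bsub>?Q\<^esub> e g"
      using e.hom_add[OF car] by (simp only:)
    then have "e f = e g \<longleftrightarrow> e ?d \<oplus>\<^bsub>?Q\<^esub> e g = \<zero>\<^bsub>?Q\<^esub> \<oplus>\<^bsub>?Q\<^esub> e g"
      using e.hom_closed[OF car(2)] by simp
    also have "\<dots> \<longleftrightarrow> e ?d = \<zero>\<^bsub>?Q\<^esub>"
      by (rule T.Q.add.right_cancel[OF e.hom_closed[OF car(2)] e.hom_closed[OF car(1)] T.Q.zero_closed])
    finally have "e f = e g \<longleftrightarrow> e ?d = \<zero>\<^bsub>?Q\<^esub>" .
    then show ?thesis
      using e_zero[OF d] by simp
  qed
  \<comment> \<open>\<open>Y\<close> is nonempty, so the constant \<open>1\<close> does not vanish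
    on it. Hence the residue ring is nonzero, and the ring map \<open>u\<close> out of a field is
    injective.\<close>
  have one_Q: "\<one>\<^bsub>?Q\<^esub> \<noteq> \<zero>\<^bsub>?Q\<^esub>"
    using e_zero[OF polynomial_functions.const[of 1]] e.hom_one irr
    by (auto simp: irreducible_closed_def)
  have "u ` carrier K \<noteq> {\<zero>\<^bsub>?Q\<^esub>}"
  proof
    assume "u ` carrier K = {\<zero>\<^bsub>?Q\<^esub>}"
    then have "u \<one>\<^bsub>K\<^esub> = \<zero>\<^bsub>?Q\<^esub>"
      using KC.one_closed by blast
    with one_Q show False
      unfolding u.hom_one by (rule notE)
  qed
  then have "inj_on u (carrier K)"
    by (rule u.non_trivial_field_hom_imp_inj[OF KC.field_axioms])
  then have u_inj: "c = c'" if "u c = u c'" "c \<in> carrier K" "c' \<in> carrier K" for c c'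
    using that by (rule inj_onD)

  have E_iff: "c \<in> ?E \<longleftrightarrow> c \<in> carrier K \<and> (\<exists>f\<in>?P. e f = u c)" for c
    by (simp add: embedded_coordinate_ring_def extension_ring_def extension_tensor_def
        e_def u_def T.tensor_class_def del: coordinate_ring_simps)

  \<comment> \<open>Restriction of invariant fractions to \<open>Y\<close>\<close>
  have den_nonzero: "restrict b Y \<in> carrier ?R - {\<zero>\<^bsub>?R\<^esub>}"
    if "b \<in> carrier ?A" "b \<noteq> \<zero>\<^bsub>?B\<^esub>" for b
  proof -
    \<comment> \<open>A nonzero invariant stays nonzero in \<open>K\<close> and, by injectivity of
      \<open>u\<close>, in the residue ring, where it equals \<open>e b\<close>.\<close>
    have "u (?j b) \<noteq> u \<zero>\<^bsub>K\<^esub>"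
      using u_inj[of "?j b" "\<zero>\<^bsub>K\<^esub>"] j_nonzero[OF that] j_closed[OF that(1)] by auto
    then have "e b \<noteq> \<zero>\<^bsub>?Q\<^esub>"
      using eu[OF that(1)] by simp
    moreover have "b \<in> ?P"
      using that(1) A_sub by blast
    ultimately obtain y where "y \<in> Y" "b y \<noteq> 0"
      using e_zero by blast
    then have "restrict b Y \<noteq> \<zero>\<^bsub>?R\<^esub>"
      by (metis coordinate_ring_simps(5) restrict_apply')
    then show ?thesis
      using that(1) A_sub by auto
  qed
  \<comment> \<open>Restricting the cross-multiplied identity to \<open>Y\<close> shows that all
    admissible representatives contribute the same class. By \<open>den_nonzero\<close>,
    \<open>(a, b)\<close> is one of them, so the defining union is nonempty.\<close>
  have res_fraction: "?res (fraction ?B a b) = fraction ?R (restrict a Y) (restrict b Y)"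
    if ab: "a \<in> carrier ?A" "b \<in> carrier ?A" "b \<noteq> \<zero>\<^bsub>?B\<^esub>" for a b
  proof -
    have "fraction ?R (restrict c Y) (restrict d Y) = fraction ?R (restrict a Y) (restrict b Y)"
      if cd: "(c, d) \<in> fraction ?B a b" "\<exists>y\<in>Y. d y \<noteq> 0" for c d
    proof -
      have c: "c \<in> ?P" "d \<in> ?P" and eq: "a \<otimes>\<^bsub>?B\<^esub> d = c \<otimes>\<^bsub>?B\<^esub> b"
        using cd(1) by (auto simp: fraction_def)
      have "a y * d y = c y * b y" for y
        using fun_cong[OF eq, of y] by simp
      then have "restrict c Y \<otimes>\<^bsub>?R\<^esub> restrict b Y = restrict a Y \<otimes>\<^bsub>?R\<^esub> restrict d Y"
        by auto
      moreover have "restrict d Y \<in> carrier ?R - {\<zero>\<^bsub>?R\<^esub>}"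
        using c(2) cd(2) by (metis DiffI coordinate_ring_simps(1,5) image_eqI restrict_apply' singletonD)
      moreover have "restrict c Y \<in> carrier ?R" "restrict a Y \<in> carrier ?R"
        using c(1) ab(1) A_sub by auto
      ultimately show ?thesis
        using den_nonzero[OF ab(2,3)] by (simp add: R.fraction_eq_iff del: coordinate_ring_simps)
    qed
    note const = this
    let ?S = "{(c, d). (c, d) \<in> fraction ?B a b \<and> (\<exists>y\<in>Y. d y \<noteq> 0)}"
    have "(a, b) \<in> fraction ?B a b"
      using ab carA by (simp add: fraction_def del: coordinate_ring_simps)
    moreover have "\<exists>y\<in>Y. b y \<noteq> 0"
      using den_nonzero[OF ab(2,3)] by (auto cong: restrict_cong)
    ultimately have ne: "?S \<noteq> {}"
      by blast
    show ?thesis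
      unfolding restrict_rational_def
    proof (rule SUP_eq_const[OF ne])
      fix z assume z: "z \<in> ?S"
      obtain c d where cd: "z = (c, d)" by (cases z)
      show "(case z of (c, d) \<Rightarrow> fraction ?R (restrict c Y) (restrict d Y)) =
          fraction ?R (restrict a Y) (restrict b Y)"
        using const[of c d] z unfolding cd by simp
    qed
  qed

  have res_polynomial: "?res (fraction ?B a \<one>\<^bsub>?B\<^esub>) = fraction ?R (restrict a Y) \<one>\<^bsub>?R\<^esub>"
    if "a \<in> carrier ?A" for a
  proof -
    have "restrict \<one>\<^bsub>?B\<^esub> Y = \<one>\<^bsub>?R\<^esub>"
      by auto
    then show ?thesis
      using res_fraction[OF that oneA B.one_not_zero] by metis
  qed

  text \<open>An element \<open>r = a / b\<close> of \<open>\<complex>(V)\<^sup>G\<close> equals \<open>f|\<^sub>Y\<close> in \<open>K\<close> iff \<open>f b = a\<close> on \<open>Y\<close>, that is, iff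
    its restriction to \<open>Y\<close> is the regular function \<open>f|\<^sub>Y\<close>.\<close>
  have key: "e f = u (\<iota> r) \<longleftrightarrow> ?res r = fraction ?R (restrict f Y) \<one>\<^bsub>?R\<^esub>"
    if r: "r \<in> carrier ?F" and f: "f \<in> ?P" for r f
  proof -
    obtain a b where r_eq: "r = fraction ?B a b"
      and ab: "a \<in> carrier ?A" "b \<in> carrier ?A" "b \<noteq> \<zero>\<^bsub>?B\<^esub>"
      using FE[OF r] by blast
    have aP: "a \<in> ?P" "b \<in> ?P"
      using ab A_sub by auto
    have fB: "f \<in> carrier ?B" "b \<in> carrier ?B"
      unfolding carB by (fact f aP)+
    have car: "e f \<in> carrier ?Q" "\<iota> r \<in> carrier K" "?j b \<in> carrier K"
      by (fact e.hom_closed[OF fB(1)] ring_hom_closed[OF incl r] j_closed[OF ab(2)])+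
    have j_unit: "?j b \<in> Units K"
      using j_nonzero[OF ab(2,3)] car(3) by (simp add: KC.field_Units)
    \<comment> \<open>Clearing the denominator is reversible: \<open>?j b\<close> has an inverse in
      the field \<open>K\<close>, and the image of that inverse under \<open>u\<close> undoes the
      multiplication.\<close>
    have "e f = u (\<iota> r) \<longleftrightarrow> e f \<otimes>\<^bsub>?Q\<^esub> u (?j b) = u (\<iota> r) \<otimes>\<^bsub>?Q\<^esub> u (?j b)"
    proof
      let ?i = "inv\<^bsub>K\<^esub> ?j b"
      have i: "?i \<in> carrier K" "?j b \<otimes>\<^bsub>K\<^esub> ?i = \<one>\<^bsub>K\<^esub>"
        using j_unit by auto
      have cancel: "(x \<otimes>\<^bsub>?Q\<^esub> u (?j b)) \<otimes>\<^bsub>?Q\<^esub> u ?i = x" if "x \<in> carrier ?Q" for x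
      proof -
        have "(x \<otimes>\<^bsub>?Q\<^esub> u (?j b)) \<otimes>\<^bsub>?Q\<^esub> u ?i = x \<otimes>\<^bsub>?Q\<^esub> u (?j b \<otimes>\<^bsub>K\<^esub> ?i)"
          unfolding u.hom_mult[OF car(3) i(1)]
          by (rule T.Q.m_assoc[OF that u.hom_closed[OF car(3)] u.hom_closed[OF i(1)]])
        also have "\<dots> = x"
          unfolding i(2) u.hom_one by (rule T.Q.r_one[OF that])
        finally show ?thesis .
      qed
      assume "e f \<otimes>\<^bsub>?Q\<^esub> u (?j b) = u (\<iota> r) \<otimes>\<^bsub>?Q\<^esub> u (?j b)"
      then have "(e f \<otimes>\<^bsub>?Q\<^esub> u (?j b)) \<otimes>\<^bsub>?Q\<^esub> u ?i = (u (\<iota> r) \<otimes>\<^bsub>?Q\<^esub> u (?j b)) \<otimes>\<^bsub>?Q\<^esub> u ?i"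
        by (rule arg_cong)
      then show "e f = u (\<iota> r)"
        by (simp only: cancel[OF car(1)] cancel[OF u.hom_closed[OF car(2)]])
    qed simp
    also have "e f \<otimes>\<^bsub>?Q\<^esub> u (?j b) = e (f \<otimes>\<^bsub>?B\<^esub> b)"
      unfolding e.hom_mult[OF fB] eu[OF ab(2)] ..
    also have "u (\<iota> r) \<otimes>\<^bsub>?Q\<^esub> u (?j b) = e a"
      unfolding r_eq eu[OF ab(1)] incl_fraction[OF ab, symmetric]
      by (rule u.hom_mult[OF car(2,3)[unfolded r_eq], symmetric])
    also have "e (f \<otimes>\<^bsub>?B\<^esub> b) = e a \<longleftrightarrow> (\<forall>y\<in>Y. f y * b y = a y)"
      using e_eq[OF polynomial_functions.mult[OF f aP(2)] aP(1)] by simp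
    \<comment> \<open>The cross-multiplied form of \<open>a / b = f / 1\<close> over
      \<open>?R\<close>.\<close>
    also have "\<dots> \<longleftrightarrow> restrict a Y \<otimes>\<^bsub>?R\<^esub> \<one>\<^bsub>?R\<^esub> = restrict f Y \<otimes>\<^bsub>?R\<^esub> restrict b Y"
      by (auto simp: fun_eq_iff restrict_def)
    also have "\<dots> \<longleftrightarrow> ?res r = fraction ?R (restrict f Y) \<one>\<^bsub>?R\<^esub>"
      using den_nonzero[OF ab(2,3)] f aP R.one_not_zero R.one_closed
      unfolding r_eq res_fraction[OF ab]
      by (intro R.fraction_eq_iff[symmetric]) (auto simp del: coordinate_ring_simps(2-5))
    finally show ?thesis .
  qed

  \<comment> \<open>Restriction from \<open>\<complex>[V]\<^sup>G\<close> to
    \<open>\<complex>[Y] \<inter> \<complex>(Y)\<^sup>W\<close>\<close>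
  have BW_iff: "h \<in> carrier ?BW \<longleftrightarrow>
      h \<in> carrier ?R \<and> fraction ?R h \<one>\<^bsub>?R\<^esub> \<in> carrier ?FW" for h
    by (simp add: birational_invariant_ring_def del: coordinate_ring_simps)
  \<comment> \<open>Closure and injectivity are both inherited from the Galois isomorphism, applied
    to fractions with denominator one.\<close>
  have restrict_closed: "restrict a Y \<in> carrier ?BW" if "a \<in> carrier ?A" for a
    unfolding BW_iff using that A_sub res_polynomial[OF that]
      res_closed[OF FI[OF that oneA B.one_not_zero]] by auto
  have restrict_inj: "inj_on (\<lambda>f. restrict f Y) (carrier ?A)"
  proof (rule inj_onI)
    fix a a' assume a: "a \<in> carrier ?A" "a' \<in> carrier ?A" and eq: "restrict a Y = restrict a' Y"
    have "?res (fraction ?B a \<one>\<^bsub>?B\<^esub>) = ?res (fraction ?B a' \<one>\<^bsub>?B\<^esub>)"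
      unfolding res_polynomial[OF a(1)] res_polynomial[OF a(2)] eq ..
    then have "fraction ?B a \<one>\<^bsub>?B\<^esub> = fraction ?B a' \<one>\<^bsub>?B\<^esub>"
      by (rule res_inj) (fact FI[OF a(1) oneA B.one_not_zero] FI[OF a(2) oneA B.one_not_zero])+
    moreover have "\<one>\<^bsub>?B\<^esub> \<in> carrier ?B - {\<zero>\<^bsub>?B\<^esub>}"
      using B.one_closed B.one_not_zero by blast
    ultimately have "a \<otimes>\<^bsub>?B\<^esub> \<one>\<^bsub>?B\<^esub> = a' \<otimes>\<^bsub>?B\<^esub> \<one>\<^bsub>?B\<^esub>"
      using B.fraction_eq_iff carA[OF a(1)] carA[OF a(2)] by blast
    then show "a = a'"
      unfolding B.r_one[OF carA[OF a(1)]] B.r_one[OF carA[OF a(2)]] .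
  qed
  have restrict_hom: "(\<lambda>f. restrict f Y) \<in> ring_hom ?A ?BW"
    by (rule ring_hom_memI)
      (use restrict_closed in \<open>auto simp: invariant_ring_def birational_invariant_ring_def\<close>)
  \<comment> \<open>Only surjectivity of restriction remains in question.\<close>
  have iso_iff: "(\<lambda>f. restrict f Y) \<in> ring_iso ?A ?BW \<longleftrightarrow>
      carrier ?BW \<subseteq> (\<lambda>f. restrict f Y) ` carrier ?A"
    using restrict_hom restrict_inj restrict_closed
    by (auto simp: ring_iso_def bij_betw_def)

  \<comment> \<open>Surjectivity of restriction versus the intersection in \<open>K\<close>\<close>
  have main: "(\<lambda>f. restrict f Y) \<in> ring_iso ?A ?BW \<longleftrightarrow>
      ?E \<inter> \<iota> ` carrier ?F = ?j ` carrier ?A"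
  proof
    assume surj: "(\<lambda>f. restrict f Y) \<in> ring_iso ?A ?BW"
    show "?E \<inter> \<iota> ` carrier ?F = ?j ` carrier ?A"
    proof (intro equalityI subsetI)
      fix c assume "c \<in> ?E \<inter> \<iota> ` carrier ?F"
      then obtain r f where r: "r \<in> carrier ?F" "c = \<iota> r" and f: "f \<in> ?P" "e f = u (\<iota> r)"
        and cK: "c \<in> carrier K"
        by (auto simp: E_iff)
      \<comment> \<open>By \<open>key\<close>, the fraction of \<open>restrict f Y\<close> over one
        is \<open>?res r\<close>, which lies in \<open>?FW\<close>.\<close>
      have "restrict f Y \<in> carrier ?BW"
        unfolding BW_iff using f res_closed[OF r(1)] key[OF r(1) f(1)] by auto
      then obtain a where a: "a \<in> carrier ?A" "restrict f Y = restrict a Y"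
        using surj unfolding iso_iff by blast
      have "e f = e a"
      proof -
        have "f y = a y" if "y \<in> Y" for y
          using fun_cong[OF a(2), of y] that by simp
        then show ?thesis
          using e_eq[OF f(1), of a] a(1) A_sub by blast
      qed
      then have "u c = u (?j a)"
        using f(2) r(2) eu[OF a(1)] by simp
      then show "c \<in> ?j ` carrier ?A"
        using u_inj[OF _ cK j_closed[OF a(1)]] a(1) by blast
    next
      fix c assume "c \<in> ?j ` carrier ?A"
      then obtain a where a: "a \<in> carrier ?A" "c = ?j a" by blast
      \<comment> \<open>The function \<open>a\<close> itself witnesses membership in
        \<open>?E\<close>, and \<open>a / 1\<close> witnesses membership in the image of
        \<open>\<iota>\<close>.\<close>
      then show "c \<in> ?E \<inter> \<iota> ` carrier ?F"
        using eu[OF a(1)] j_closed[OF a(1)] A_sub FI[OF a(1) oneA B.one_not_zero]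
        unfolding E_iff Int_iff invariant_inclusion_def by blast
    qed
  next
    assume eq: "?E \<inter> \<iota> ` carrier ?F = ?j ` carrier ?A"
    show "(\<lambda>f. restrict f Y) \<in> ring_iso ?A ?BW"
      unfolding iso_iff
    proof
      fix h assume h: "h \<in> carrier ?BW"
      then obtain f where f: "f \<in> ?P" "h = restrict f Y"
        by (auto simp: BW_iff)
      \<comment> \<open>Surjectivity of the Galois isomorphism lifts \<open>h / 1\<close> to an
        invariant fraction \<open>r\<close>; \<open>key\<close> then identifies
        \<open>\<iota> r\<close> with the class of \<open>f\<close>, putting it in the
        intersection.\<close>
      obtain r where r: "r \<in> carrier ?F" "?res r = fraction ?R h \<one>\<^bsub>?R\<^esub>"
        using h res_surj unfolding BW_iff by blast
      then have ef: "e f = u (\<iota> r)"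
        using key f by simp
      then have "\<iota> r \<in> ?E \<inter> \<iota> ` carrier ?F"
        using r(1) f(1) ring_hom_closed[OF incl r(1)] by (auto simp: E_iff)
      then obtain a where a: "a \<in> carrier ?A" "\<iota> r = ?j a"
        unfolding eq by blast
      then have "e f = e a"
        using ef eu by simp
      then have "h = restrict a Y"
        using f a(1) A_sub e_eq[of f a] by (auto cong: restrict_cong)
      with a(1) show "h \<in> (\<lambda>f. restrict f Y) ` carrier ?A"
        by blast
    qed
  qed
  \<comment> \<open>For a regular action the pointwise and birational invariant rings coincide, so
    \<open>main\<close> applies to the Chevalley property as well.\<close>
  have "chevalley_restriction_property scl G \<rho> Y W \<phi> \<longleftrightarrow>
      (\<lambda>f. restrict f Y) \<in> ring_iso ?A ?BW"
    if reg: "faithful_regular_action scl Y W \<phi>"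
  proof -
    have "invariant_ring scl Y (carrier W) \<phi> = ?BW"
      using reg by (intro invariant_ring_eq_birational_invariant_ring irr)
        (auto simp: faithful_regular_action_def)
    then show ?thesis
      using reg irr by (simp add: chevalley_restriction_property_def)
  qed
  with main show ?thesis
    by blast
qed

end
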